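(* Suppose that $u$ satisfies \begin{equation*} \left\{ \begin{array}{lll}Lu = (\sum_{i,k=1}^n\partial_{x_i}(a_{ik}(x,t)\partial_{x_k})+\sum_{l=1}^m x_l\partial_{y_l}-\partial_t) u =c(x,t)u+\sum_{i=1}^nd(x,t)_{i}\partial_{x_i} u,\\ u(x,y,0)=0\quad (x,y)\in \mathbb{R}^{n+m},\\ u, \nabla_x u, (\sum_{l=1}^m x_l\partial_{y_l}+\partial_t) u\in L^2(\mathbb{R}^{n+m}\times (0,T)), \end{array}\right. \end{equation*} where the coefficients are symmetric and uniformly elliptic: $a_{ik}(x,t)=a_{ki}(x,t)$ for $1\leq i,k\leq n$, and $\lambda^{-1}|\xi|^2\leq \sum_{i,k=1}^n\xi_ia_{ik}(x,t)\xi_k\leq \lambda|\xi|^2$ for all $(x,t)\in \mathbb{R}^{n}\times (0, T)$ and $\xi\in \mathbb{R}^{n}$, with a constant $\lambda>1$. We assume that $a(x,t)\in C^{0,1}$ and $c(x,t)$, $d(x,t)$ are bounded functions. Then $u\equiv 0$ in $\mathbb{R}^{n+m}\times(0,T)$.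
   Context: Here $m\leq n$, $x=(x_1,\cdots,x_n)\in\mathbb{R}^n$, $y=(y_1,\cdots,y_m)\in\mathbb{R}^m$, $(x,y,t)\in\mathbb{R}^{n}\times \mathbb{R}^{m}\times (0, T)$. The coefficients $a_{ik}$, $c$, $d$ depend only on $(x,t)$ (not on $y$). $a\in C^{0,1}$ means $\nabla_x a_{ik}$ and $\partial_t a_{ik}$ are bounded; in the proof it is assumed $|\nabla_x a_{ij}|,|\partial_t a_{ij}|,|c|,|d|\leq\lambda$. *)

theory Defs
  imports "HOL-Analysis.Analysis"
begin

type_synonym ('n,'m) pt = "((real^'n) \<times> (real^'m)) \<times> real"

text \<open>C-infinity: every iterated directional derivative exists (everywhere).\<close>
definition smooth_fun :: "('a::euclidean_space \<Rightarrow> real) \<Rightarrow> bool" where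
  "smooth_fun f \<longleftrightarrow> (\<exists>F. f \<in> F \<and> (\<forall>g\<in>F. (\<forall>p. g differentiable at p) \<and>
       (\<forall>v. (\<lambda>p. frechet_derivative g (at p) v) \<in> F)))"

definition test_fun :: "'a::euclidean_space set \<Rightarrow> ('a \<Rightarrow> real) \<Rightarrow> bool" where
  "test_fun U \<phi> \<longleftrightarrow> smooth_fun \<phi> \<and> (\<exists>K. compact K \<and> K \<subseteq> U \<and> (\<forall>p. p \<notin> K \<longrightarrow> \<phi> p = 0))"

definition dx :: "'n \<Rightarrow> (('n::finite,'m::finite) pt \<Rightarrow> real) \<Rightarrow> ('n,'m) pt \<Rightarrow> real" where
  "dx i \<phi> p = frechet_derivative \<phi> (at p) ((axis i 1, 0), 0)"
definition dy :: "'m \<Rightarrow> (('n::finite,'m::finite) pt \<Rightarrow> real) \<Rightarrow> ('n,'m) pt \<Rightarrow> real" where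
  "dy l \<phi> p = frechet_derivative \<phi> (at p) ((0, axis l 1), 0)"
definition dt :: "(('n::finite,'m::finite) pt \<Rightarrow> real) \<Rightarrow> ('n,'m) pt \<Rightarrow> real" where
  "dt \<phi> p = frechet_derivative \<phi> (at p) ((0, 0), 1)"

definition Omega :: "real \<Rightarrow> ('n::finite,'m::finite) pt set" where
  "Omega T = {p. 0 < snd p \<and> snd p < T}"

definition L2_on :: "'a::euclidean_space set \<Rightarrow> ('a \<Rightarrow> real) \<Rightarrow> bool" where
  "L2_on S f \<longleftrightarrow> f \<in> borel_measurable lborel \<and> set_integrable lborel S (\<lambda>p. (f p)\<^sup>2)"

end

theory Submission
  imports Defs "HOL-Computational_Algebra.Polynomial"
begin

text \<open>
  The equation is a forward one: extended by \<open>0\<close> to \<open>t \<le> 0\<close>, the function \<open>u\<close> solves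
  \<open>\<partial>\<^sub>t u - x \<cdot> \<partial>\<^sub>y u = div (a \<nabla>\<^sub>x u) - c u - d \<cdot> \<nabla>\<^sub>x u\<close> weakly on \<open>t < T\<close>, the extension being
  legitimate because the initial value vanishes. So a direct energy estimate works, once it is
  justified for a merely square integrable \<open>u\<close>. Testing with a mollifier gives a pointwise
  equation for the regularised \<open>u\<close>; the commutator of mollification with the transport term is the
  convolution of \<open>u\<close> with the kernel \<open>x \<cdot> \<partial>\<^sub>y \<rho>\<close>, which scales like \<open>\<rho>\<close> itself and has integral \<open>0\<close>,
  hence tends to \<open>0\<close> in \<open>L\<^sup>2\<close>. Multiplying by the regularised \<open>u\<close> times a cutoff and integrating by
  parts, all terms pass to the limit. The cutoff \<open>(1 - (|x|\<^sup>2 + |y|\<^sup>2) / R\<^sup>2)\<^sub>+\<^sup>2\<close> in space tolerates the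
  unbounded drift as \<open>R\<close> tends to infinity, and a weight in time decaying faster than the growth
  rate \<open>C\<close> of the energy forces \<open>u = 0\<close>.
\<close>

subsection \<open>Smooth functions\<close>

text \<open>The function \<open>u\<close> is no admissible test function: square integrability is
  known for \<open>u\<close> and its weak x-gradient, and for a combination of y- and t-derivatives,
  but not for these derivatives singly. Mollification in all variables supplies them. The flux F_i =
  sum over k of a_ik G_k is kept as one L2 function and mollified as a whole, so the only factor in
  the equation that fails to commute with the mollifier is x_l. Writing x_l(p) = x_l(z) - x_l(z - p)
  takes it out of the convolution. The error stays of the order of \<open>u\<close>, not of a
  derivative of \<open>u\<close>, because the extra factor x_l cancels the power of the scale gained
  by differentiating the mollifier. Since all smoothness demands are met by the mollifier, the
  cutoffs need only be C1, and squared positive parts with explicit derivatives suffice. The rate of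
  the time weight is 3 + 2 C: the zero order loss C counts twice because the derivative of u^2 is 2
  u u_t, another 2 pays for switching the weight on before t = 0, and the remaining 1 is the surplus
  that makes \<open>u\<close> vanish.\<close>

lemma smooth_funI:
  assumes "f \<in> F" "\<And>g p. g \<in> F \<Longrightarrow> g differentiable at p"
    "\<And>g v. g \<in> F \<Longrightarrow> (\<lambda>p. frechet_derivative g (at p) v) \<in> F"
  shows "smooth_fun f"
  unfolding smooth_fun_def using assms by (intro exI[of _ F]) simp

lemma smooth_fun_differentiable: "smooth_fun f \<Longrightarrow> f differentiable at p"
  unfolding smooth_fun_def by blast

lemma smooth_fun_frechet:
  assumes "smooth_fun f"
  shows "smooth_fun (\<lambda>p. frechet_derivative f (at p) v)"
proof -
  obtain F where F: "f \<in> F" "\<And>g p. g \<in> F \<Longrightarrow> g differentiable at p"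
    "\<And>g v. g \<in> F \<Longrightarrow> (\<lambda>p. frechet_derivative g (at p) v) \<in> F"
    using assms unfolding smooth_fun_def by blast
  then show ?thesis by (intro smooth_funI[where F = F])
qed

lemma smooth_fun_has_derivative:
  "smooth_fun f \<Longrightarrow> (f has_derivative frechet_derivative f (at p)) (at p)"
  by (simp add: smooth_fun_differentiable flip: frechet_derivative_works)

lemma smooth_fun_continuous: "smooth_fun f \<Longrightarrow> continuous_on S f"
  by (meson continuous_at_imp_continuous_on differentiable_imp_continuous_within
      smooth_fun_differentiable)

lemma frechet_derivative_eq:
  "(f has_derivative f') (at p) \<Longrightarrow> frechet_derivative f (at p) = f'"
  by (rule frechet_derivative_at[symmetric])

lemma smooth_fun_const: "smooth_fun (\<lambda>p::'a::euclidean_space. c)"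
proof (rule smooth_funI[where F = "range (\<lambda>c p. c)"])
  fix g :: "'a \<Rightarrow> real" and v assume "g \<in> range (\<lambda>c p. c)"
  then obtain c where "g = (\<lambda>p. c)" by auto
  then have "(\<lambda>p. frechet_derivative g (at p) v) = (\<lambda>p. 0)"
    by (simp add: frechet_derivative_eq[OF has_derivative_const])
  then show "(\<lambda>p. frechet_derivative g (at p) v) \<in> range (\<lambda>c p. c)" by (metis rangeI)
qed auto

text \<open>The Leibniz rule leaves the set of single products, so a family that witnesses
  smoothness of a product must contain finite sums. Sums of products with one factor from each
  witnessing family are stable under every directional derivative.\<close>

inductive sum_prods :: "('a::euclidean_space \<Rightarrow> real) set \<Rightarrow> ('a \<Rightarrow> real) set \<Rightarrow> ('a \<Rightarrow> real) \<Rightarrow> bool"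
  for F1 F2 where
  prod: "f \<in> F1 \<Longrightarrow> g \<in> F2 \<Longrightarrow> sum_prods F1 F2 (\<lambda>p. f p * g p)"
| add: "sum_prods F1 F2 f \<Longrightarrow> sum_prods F1 F2 g \<Longrightarrow> sum_prods F1 F2 (\<lambda>p. f p + g p)"

lemma smooth_fun_mult:
  assumes "smooth_fun f" "smooth_fun g"
  shows "smooth_fun (\<lambda>p. f p * g p)"
proof -
  obtain F1 where F1: "f \<in> F1" "\<And>g p. g \<in> F1 \<Longrightarrow> g differentiable at p"
    "\<And>g v. g \<in> F1 \<Longrightarrow> (\<lambda>p. frechet_derivative g (at p) v) \<in> F1"
    using assms(1) unfolding smooth_fun_def by blast
  obtain F2 where F2: "g \<in> F2" "\<And>g p. g \<in> F2 \<Longrightarrow> g differentiable at p"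
    "\<And>g v. g \<in> F2 \<Longrightarrow> (\<lambda>p. frechet_derivative g (at p) v) \<in> F2"
    using assms(2) unfolding smooth_fun_def by blast
  have *: "(\<forall>p. h differentiable at p) \<and>
      (\<forall>v. sum_prods F1 F2 (\<lambda>p. frechet_derivative h (at p) v))" if "sum_prods F1 F2 h" for h
    using that
  proof induction
    case (prod f g)
    have "frechet_derivative (\<lambda>p. f p * g p) (at p) =
        (\<lambda>v. f p * frechet_derivative g (at p) v + frechet_derivative f (at p) v * g p)" for p
      using prod F1(2) F2(2)
      by (intro frechet_derivative_eq has_derivative_mult) (auto simp flip: frechet_derivative_works)
    then show ?case
      using prod F1(2,3) F2(2,3) by (auto intro!: sum_prods.intros differentiable_mult)
  next
    case (add f g)
    have "frechet_derivative (\<lambda>p. f p + g p) (at p) =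
        (\<lambda>v. frechet_derivative f (at p) v + frechet_derivative g (at p) v)" for p
      using add
      by (intro frechet_derivative_eq has_derivative_add) (auto simp flip: frechet_derivative_works)
    then show ?case using add by (auto intro!: sum_prods.intros)
  qed
  show ?thesis
    by (rule smooth_funI[where F = "Collect (sum_prods F1 F2)"])
      (use F1(1) F2(1) * in \<open>auto intro: sum_prods.prod\<close>)
qed

lemma smooth_fun_prod:
  assumes "finite A" "\<And>i. i \<in> A \<Longrightarrow> smooth_fun (f i)"
  shows "smooth_fun (\<lambda>p. \<Prod>i\<in>A. f i p)"
  using assms
proof induction
  case empty
  show ?case by (simp add: smooth_fun_const)
next
  case (insert i A)
  then show ?case by (simp add: smooth_fun_mult)
qed

text \<open>By the chain rule a derivative in direction \<open>v\<close> becomes one in direction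
  \<open>L v\<close>, composed with the same affine map. Hence the witnessing family of
  \<open>f\<close>, pulled back by that map, is already closed.\<close>

lemma smooth_fun_affine:
  fixes f :: "'b::euclidean_space \<Rightarrow> real" and L :: "'a::euclidean_space \<Rightarrow> 'b"
  assumes "smooth_fun f" and L: "bounded_linear L"
  shows "smooth_fun (\<lambda>p. f (L p + b))"
proof -
  obtain F where F: "f \<in> F" "\<And>g p. g \<in> F \<Longrightarrow> g differentiable at p"
    "\<And>g v. g \<in> F \<Longrightarrow> (\<lambda>p. frechet_derivative g (at p) v) \<in> F"
    using assms(1) unfolding smooth_fun_def by blast
  have D: "((\<lambda>p. g (L p + b)) has_derivative (\<lambda>v. frechet_derivative g (at (L p + b)) (L v))) (at p)"
    if "g \<in> F" for g p
  proof -
    have "((\<lambda>p. L p + b) has_derivative L) (at p)"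
      by (auto intro!: derivative_eq_intros bounded_linear.has_derivative[OF L])
    moreover have "(g has_derivative frechet_derivative g (at (L p + b))) (at (L p + b))"
      using F(2)[OF that] frechet_derivative_works by blast
    ultimately show ?thesis by (rule has_derivative_compose)
  qed
  show ?thesis
  proof (rule smooth_funI[where F = "(\<lambda>g p. g (L p + b)) ` F"])
    fix h p v assume "h \<in> (\<lambda>g p. g (L p + b)) ` F"
    then obtain g where g: "g \<in> F" "h = (\<lambda>p. g (L p + b))" by auto
    show "h differentiable at p" using D[OF g(1)] g(2) by (auto simp: differentiable_def)
    have "(\<lambda>p. frechet_derivative h (at p) v)
        = (\<lambda>p. (\<lambda>q. frechet_derivative g (at q) (L v)) (L p + b))"
      using frechet_derivative_eq[OF D[OF g(1)]] g(2) by auto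
    then show "(\<lambda>p. frechet_derivative h (at p) v) \<in> (\<lambda>g p. g (L p + b)) ` F"
      using F(3)[OF g(1), of "L v"] by simp
  qed (use F(1) in auto)
qed

section \<open>The flat function exp (- 1 / t)\<close>

definition flat_exp :: "real poly \<Rightarrow> real \<Rightarrow> real" where
  "flat_exp q t = (if t > 0 then poly q (1 / t) * exp (- (1 / t)) else 0)"

lemma poly_exp_tendsto_0: "((\<lambda>s. poly q s * exp (- s)) \<longlongrightarrow> (0::real)) at_top"
proof -
  have "((\<lambda>s. \<Sum>i\<le>degree q. coeff q i * (s ^ i / exp s)) \<longlongrightarrow> (\<Sum>i\<le>degree q. coeff q i * 0)) at_top"
    by (intro tendsto_intros tendsto_power_div_exp_0)
  moreover have "(\<lambda>s. \<Sum>i\<le>degree q. coeff q i * (s ^ i / exp s)) = (\<lambda>s. poly q s * exp (- s))"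
    by (simp add: fun_eq_iff poly_altdef sum_distrib_right exp_minus divide_inverse mult.assoc)
  ultimately show ?thesis by simp
qed

text \<open>With s = 1 / t one has ds/dt = - s^2, so q(s) exp(-s) has the derivative s^2 (q(s) -
  q'(s)) exp(-s), and \<open>[:0, 0, 1:]\<close> is s^2. Differentiation only changes the
  polynomial, which makes the range of \<open>flat_exp\<close> its own witnessing family. At t = 0
  the right difference quotient is s q(s) exp(-s) with s tending to infinity.\<close>

lemma flat_exp_has_derivative:
  "(flat_exp q has_real_derivative flat_exp ([:0, 0, 1:] * (q - pderiv q)) t) (at t)"
proof (cases t "0::real" rule: linorder_cases)
  case greater
  have "((\<lambda>t. poly q (1 / t) * exp (- (1 / t))) has_real_derivative
      flat_exp ([:0, 0, 1:] * (q - pderiv q)) t) (at t)"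
  proof (rule DERIV_cong)
    have i: "((\<lambda>t. 1 / t) has_real_derivative - (1 / t ^ 2)) (at t)"
      using greater by (auto intro!: derivative_eq_intros simp: power2_eq_square)
    show "((\<lambda>t. poly q (1 / t) * exp (- (1 / t))) has_real_derivative
      poly (pderiv q) (1 / t) * (- (1 / t ^ 2)) * exp (- (1 / t))
        + exp (- (1 / t)) * (- (- (1 / t ^ 2))) * poly q (1 / t)) (at t)"
      by (intro DERIV_mult DERIV_chain2[OF poly_DERIV] DERIV_chain2[OF DERIV_exp] DERIV_minus i)
    show "poly (pderiv q) (1 / t) * (- (1 / t ^ 2)) * exp (- (1 / t))
        + exp (- (1 / t)) * (- (- (1 / t ^ 2))) * poly q (1 / t) =
        flat_exp ([:0, 0, 1:] * (q - pderiv q)) t"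
      using greater by (simp add: flat_exp_def power2_eq_square algebra_simps)
  qed
  then show ?thesis
    by (rule has_field_derivative_transform_within_open[where S = "{0<..}"])
      (use greater in \<open>auto simp: flat_exp_def\<close>)
next
  case less
  have "((\<lambda>t. 0) has_real_derivative flat_exp ([:0, 0, 1:] * (q - pderiv q)) t) (at t)"
    using less by (simp add: flat_exp_def)
  then show ?thesis
    by (rule has_field_derivative_transform_within_open[where S = "{..<0}"])
      (use less in \<open>auto simp: flat_exp_def\<close>)
next
  case equal
  have "((\<lambda>h. poly ([:0, 1:] * q) (inverse h) * exp (- inverse h)) \<longlongrightarrow> 0) (at_right 0)"
    using filterlim_compose[OF poly_exp_tendsto_0 filterlim_inverse_at_top_right, of "[:0,1:] * q"]
    by simp
  then have "((\<lambda>h. flat_exp q h / h) \<longlongrightarrow> 0) (at_right 0)"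
    by (rule Lim_transform_eventually)
      (auto simp: eventually_at_filter flat_exp_def divide_inverse algebra_simps)
  moreover have "((\<lambda>h. flat_exp q h / h) \<longlongrightarrow> 0) (at_left 0)"
    by (rule Lim_transform_eventually[OF tendsto_const])
      (auto simp: eventually_at_filter flat_exp_def)
  ultimately have "((\<lambda>h. flat_exp q h / h) \<longlongrightarrow> 0) (at 0)"
    using filterlim_split_at by blast
  then show ?thesis using equal by (simp add: DERIV_def flat_exp_def)
qed

lemma smooth_fun_flat_exp: "smooth_fun (flat_exp q)"
proof (rule smooth_funI[where F = "range flat_exp"])
  fix g :: "real \<Rightarrow> real" and p v :: real assume "g \<in> range flat_exp"
  then obtain q where g: "g = flat_exp q" by auto
  note D = flat_exp_has_derivative[of q, unfolded has_field_derivative_def]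
  show "g differentiable at p" using D g by (auto simp: differentiable_def)
  have "(\<lambda>p. frechet_derivative g (at p) v) = flat_exp (smult v ([:0, 0, 1:] * (q - pderiv q)))"
    by (simp add: g frechet_derivative_eq[OF D]) (simp add: flat_exp_def fun_eq_iff)
  then show "(\<lambda>p. frechet_derivative g (at p) v) \<in> range flat_exp" by simp
qed simp

subsection \<open>Square integrable functions and convolution\<close>

lemma nn_integral_lborel_affine:
  fixes f :: "'a::euclidean_space \<Rightarrow> ennreal"
  assumes [measurable]: "f \<in> borel_measurable borel" and c: "c \<noteq> 0"
  shows "(\<integral>\<^sup>+x. f x \<partial>lborel) = \<bar>c\<bar> ^ DIM('a) * (\<integral>\<^sup>+x. f (t + c *\<^sub>R x) \<partial>lborel)"
  by (subst lborel_affine[OF c, of t])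
    (simp add: nn_integral_density nn_integral_distr nn_integral_cmult ennreal_power)

lemma integral_lborel_affine:
  fixes f :: "'a::euclidean_space \<Rightarrow> real"
  assumes [measurable]: "f \<in> borel_measurable borel" and c: "c \<noteq> 0"
  shows "(\<integral>x. f x \<partial>lborel) = \<bar>c\<bar> ^ DIM('a) * (\<integral>x. f (t + c *\<^sub>R x) \<partial>lborel)"
  by (subst lborel_affine[OF c, of t])
    (simp add: integral_density integral_distr)

lemma integrable_lborel_affine:
  fixes f :: "'a::euclidean_space \<Rightarrow> real"
  assumes "integrable lborel f" and c: "c \<noteq> 0"
  shows "integrable lborel (\<lambda>x. f (t + c *\<^sub>R x))"
proof -
  have [measurable]: "f \<in> borel_measurable borel"
    using borel_measurable_integrable[OF assms(1)] by simp
  show ?thesis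
    using assms(1) nn_integral_lborel_affine[OF _ c, of "\<lambda>x. norm (f x)" t] c
    unfolding integrable_iff_bounded by (auto simp: ennreal_mult_less_top)
qed

lemma integral_lborel_plus:
  fixes f :: "'a::euclidean_space \<Rightarrow> real"
  assumes "f \<in> borel_measurable borel"
  shows "(\<integral>x. f (x + t) \<partial>lborel) = (\<integral>x. f x \<partial>lborel)"
  using integral_lborel_affine[OF assms, of 1 t] by (simp add: add.commute)

text \<open>These are honest Borel functions on the whole space, not classes modulo null sets, so
  that cutoffs, extensions by 0 and the coercivity bound can be handled pointwise. Functions that
  are square integrable only on a set enter after multiplication by its indicator.\<close>

definition L2fun :: "('a::euclidean_space \<Rightarrow> real) \<Rightarrow> bool" where
  "L2fun f \<longleftrightarrow> f \<in> borel_measurable borel \<and> integrable lborel (\<lambda>x. (f x)\<^sup>2)"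

lemma L2fun_measurable [measurable_dest]: "L2fun f \<Longrightarrow> f \<in> borel_measurable borel"
  and L2fun_integrable: "L2fun f \<Longrightarrow> integrable lborel (\<lambda>x. (f x)\<^sup>2)"
  by (auto simp: L2fun_def)

lemma L2fun_bound:
  assumes "f \<in> borel_measurable borel" "integrable lborel g" "\<And>x. (f x)\<^sup>2 \<le> g x"
  shows "L2fun f"
  unfolding L2fun_def using assms
  by (auto intro!: Bochner_Integration.integrable_bound[OF assms(2)] order_trans[OF assms(3) abs_ge_self])

lemma L2fun_add:
  assumes f: "L2fun f" and g: "L2fun g"
  shows "L2fun (\<lambda>x. f x + g x)"
proof (rule L2fun_bound)
  show "(\<lambda>x. f x + g x) \<in> borel_measurable borel"
    using f g by measurable
  show "integrable lborel (\<lambda>x. 2 * (f x)\<^sup>2 + 2 * (g x)\<^sup>2)"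
    using L2fun_integrable[OF f] L2fun_integrable[OF g] by simp
  show "(f x + g x)\<^sup>2 \<le> 2 * (f x)\<^sup>2 + 2 * (g x)\<^sup>2" for x
    using zero_le_power2[of "f x - g x"] by (simp add: power2_eq_square algebra_simps)
qed

lemma L2fun_mult_bounded:
  assumes f: "L2fun f" and b: "b \<in> borel_measurable borel" "\<And>x. \<bar>b x\<bar> \<le> M"
  shows "L2fun (\<lambda>x. b x * f x)"
proof (rule L2fun_bound)
  show "(\<lambda>x. b x * f x) \<in> borel_measurable borel"
    using f b(1) by measurable
  show "integrable lborel (\<lambda>x. M\<^sup>2 * (f x)\<^sup>2)"
    using L2fun_integrable[OF f] by simp
  show "(b x * f x)\<^sup>2 \<le> M\<^sup>2 * (f x)\<^sup>2" for x
  proof -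
    have "\<bar>b x\<bar>\<^sup>2 \<le> M\<^sup>2" using b(2)[of x] by (intro power_mono) auto
    then show ?thesis by (simp add: power_mult_distrib mult_right_mono)
  qed
qed

lemma L2fun_cmult: "L2fun f \<Longrightarrow> L2fun (\<lambda>x. c * f x)"
  by (rule L2fun_mult_bounded[where M = "\<bar>c\<bar>"]) auto

lemma L2fun_diff: "L2fun f \<Longrightarrow> L2fun g \<Longrightarrow> L2fun (\<lambda>x. f x - g x)"
  using L2fun_add[of f "\<lambda>x. (-1) * g x"] L2fun_cmult[of g "-1"] by simp

lemma L2fun_sum:
  assumes "finite A" "\<And>i. i \<in> A \<Longrightarrow> L2fun (f i)"
  shows "L2fun (\<lambda>x. \<Sum>i\<in>A. f i x)"
  using assms
proof induction
  case empty
  show ?case by (simp add: L2fun_def)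
next
  case (insert i A)
  then show ?case by (simp add: L2fun_add)
qed

lemma L2fun_mult_integrable:
  assumes f: "L2fun f" and g: "L2fun g"
  shows "integrable lborel (\<lambda>x. f x * g x)"
proof (rule Bochner_Integration.integrable_bound)
  show "integrable lborel (\<lambda>x. (f x)\<^sup>2 + (g x)\<^sup>2)"
    using L2fun_integrable[OF f] L2fun_integrable[OF g] by simp
  show "(\<lambda>x. f x * g x) \<in> borel_measurable lborel"
    using f g by measurable
  have "\<bar>a * b\<bar> \<le> a\<^sup>2 + b\<^sup>2" for a b :: real
  proof -
    have "0 \<le> \<bar>a\<bar> * \<bar>b\<bar>" "2 * \<bar>a\<bar> * \<bar>b\<bar> \<le> a\<^sup>2 + b\<^sup>2"
      using sum_squares_bound[of "\<bar>a\<bar>" "\<bar>b\<bar>"] by simp_all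
    then show ?thesis unfolding abs_mult by linarith
  qed
  then show "AE x in lborel. norm (f x * g x) \<le> norm ((f x)\<^sup>2 + (g x)\<^sup>2)"
    by simp
qed

lemma L2fun_mult_bounded_integrable:
  assumes f: "L2fun f" and g: "L2fun g" and b: "b \<in> borel_measurable borel" "\<And>x. \<bar>b x\<bar> \<le> M"
  shows "integrable lborel (\<lambda>x. f x * g x * b x)"
  using L2fun_mult_integrable[OF f L2fun_mult_bounded[OF g b]] by (simp add: mult_ac)

lemma L2fun_Cauchy_Schwarz:
  assumes f: "L2fun f" and g: "L2fun g"
  shows "(\<integral>x. \<bar>f x * g x\<bar> \<partial>lborel) \<le> sqrt (\<integral>x. (f x)\<^sup>2 \<partial>lborel) * sqrt (\<integral>x. (g x)\<^sup>2 \<partial>lborel)"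
proof -
  note [measurable] = L2fun_measurable[OF f] L2fun_measurable[OF g]
  have n: "(\<integral>\<^sup>+x. ennreal \<bar>f x\<bar> * ennreal \<bar>g x\<bar> \<partial>lborel) = ennreal (\<integral>x. \<bar>f x * g x\<bar> \<partial>lborel)"
    using L2fun_mult_integrable[OF f g, THEN integrable_abs]
    by (subst nn_integral_eq_integral[symmetric]) (simp_all add: ennreal_mult'[symmetric] abs_mult)
  have s: "(\<integral>\<^sup>+x. (ennreal \<bar>h x\<bar>)\<^sup>2 \<partial>lborel) = ennreal (\<integral>x. (h x)\<^sup>2 \<partial>lborel)" if "L2fun h" for h :: "'a \<Rightarrow> real"
    using L2fun_integrable[OF that]
    by (subst nn_integral_eq_integral[symmetric]) (auto simp: ennreal_power)
  have "(ennreal (\<integral>x. \<bar>f x * g x\<bar> \<partial>lborel))\<^sup>2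
      \<le> ennreal (\<integral>x. (f x)\<^sup>2 \<partial>lborel) * ennreal (\<integral>x. (g x)\<^sup>2 \<partial>lborel)"
    using Cauchy_Schwarz_nn_integral[of "\<lambda>x. ennreal \<bar>f x\<bar>" lborel "\<lambda>x. ennreal \<bar>g x\<bar>"]
    by (simp add: n s[OF f] s[OF g])
  then have "(\<integral>x. \<bar>f x * g x\<bar> \<partial>lborel)\<^sup>2 \<le> (\<integral>x. (f x)\<^sup>2 \<partial>lborel) * (\<integral>x. (g x)\<^sup>2 \<partial>lborel)"
    by (simp add: ennreal_power flip: ennreal_mult)
  then have "sqrt ((\<integral>x. \<bar>f x * g x\<bar> \<partial>lborel)\<^sup>2) \<le> sqrt ((\<integral>x. (f x)\<^sup>2 \<partial>lborel) * (\<integral>x. (g x)\<^sup>2 \<partial>lborel))"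
    by (rule real_sqrt_le_mono)
  then show ?thesis by (simp add: real_sqrt_mult)
qed

text \<open>Membership in L2 is part of the notion because a Bochner integral is 0 when its
  integrand is not integrable; the convergence to 0 alone would carry no information.\<close>

definition L2lim :: "(nat \<Rightarrow> 'a::euclidean_space \<Rightarrow> real) \<Rightarrow> ('a \<Rightarrow> real) \<Rightarrow> bool" where
  "L2lim F f \<longleftrightarrow> (\<forall>n. L2fun (F n)) \<and> L2fun f \<and> (\<lambda>n. \<integral>x. (F n x - f x)\<^sup>2 \<partial>lborel) \<longlonglongrightarrow> 0"

text \<open>FG - fg = (F - f)(G - g) + f (G - g) + (F - f) g, and by Cauchy-Schwarz each summand is
  at most a product of norms in which one factor tends to 0. The bounded weight \<open>b\<close>
  makes room for a cutoff or its derivatives.\<close>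

lemma L2lim_mult:
  assumes F: "L2lim F f" and G: "L2lim G g"
    and b: "b \<in> borel_measurable borel" "\<And>x. \<bar>b x\<bar> \<le> M"
  shows "(\<lambda>n. \<integral>x. F n x * G n x * b x \<partial>lborel) \<longlonglongrightarrow> (\<integral>x. f x * g x * b x \<partial>lborel)"
proof -
  have L: "L2fun (F n)" "L2fun (G n)" "L2fun f" "L2fun g" for n
    using F G by (auto simp: L2lim_def)
  define N where "N h = sqrt (\<integral>x. (h x)\<^sup>2 \<partial>lborel)" for h :: "'a \<Rightarrow> real"
  define u v where "u n x = F n x - f x" and "v n x = G n x - g x" for n x
  have uv: "L2fun (u n)" "L2fun (v n)" for n
    unfolding u_def v_def using L by (auto intro: L2fun_diff)
  have u0: "(\<lambda>n. N (u n)) \<longlonglongrightarrow> 0"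
    using F tendsto_real_sqrt unfolding L2lim_def N_def u_def by fastforce
  have v0: "(\<lambda>n. N (v n)) \<longlonglongrightarrow> 0"
    using G tendsto_real_sqrt unfolding L2lim_def N_def v_def by fastforce
  have "(\<lambda>n. (\<integral>x. F n x * G n x * b x \<partial>lborel) - (\<integral>x. f x * g x * b x \<partial>lborel)) \<longlonglongrightarrow> 0"
  proof (rule Lim_null_comparison)
    show "\<forall>\<^sub>F n in sequentially. norm ((\<integral>x. F n x * G n x * b x \<partial>lborel) - (\<integral>x. f x * g x * b x \<partial>lborel))
        \<le> M * (N (u n) * N (v n) + N f * N (v n) + N (u n) * N g)"
    proof (rule always_eventually, rule allI)
      fix n
      have i1: "integrable lborel (\<lambda>x. \<bar>u n x * v n x\<bar>)" "integrable lborel (\<lambda>x. \<bar>f x * v n x\<bar>)"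
        "integrable lborel (\<lambda>x. \<bar>u n x * g x\<bar>)"
        using L uv by (auto intro!: integrable_abs L2fun_mult_integrable)
      have M0: "0 \<le> M" using b(2)[of 0] by simp
      have "(\<integral>x. F n x * G n x * b x \<partial>lborel) - (\<integral>x. f x * g x * b x \<partial>lborel)
          = (\<integral>x. F n x * G n x * b x - f x * g x * b x \<partial>lborel)"
        using L b by (subst Bochner_Integration.integral_diff) (auto intro!: L2fun_mult_bounded_integrable)
      also have "norm \<dots> \<le> (\<integral>x. M * (\<bar>u n x * v n x\<bar> + \<bar>f x * v n x\<bar> + \<bar>u n x * g x\<bar>) \<partial>lborel)"
      proof (rule order_trans[OF integral_norm_bound integral_mono])
        show "integrable lborel (\<lambda>x. norm (F n x * G n x * b x - f x * g x * b x))"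
          by (intro integrable_norm Bochner_Integration.integrable_diff) (use L b in \<open>auto intro!: L2fun_mult_bounded_integrable\<close>)
        show "integrable lborel (\<lambda>x. M * (\<bar>u n x * v n x\<bar> + \<bar>f x * v n x\<bar> + \<bar>u n x * g x\<bar>))"
          using i1 by auto
        fix x
        have "F n x * G n x * b x - f x * g x * b x = b x * (u n x * v n x + f x * v n x + u n x * g x)"
          by (simp add: u_def v_def algebra_simps)
        also have "norm \<dots> \<le> M * (\<bar>u n x * v n x\<bar> + \<bar>f x * v n x\<bar> + \<bar>u n x * g x\<bar>)"
          unfolding norm_mult by (intro mult_mono) (use b(2) M0 in auto)
        finally show "norm (F n x * G n x * b x - f x * g x * b x)
          \<le> M * (\<bar>u n x * v n x\<bar> + \<bar>f x * v n x\<bar> + \<bar>u n x * g x\<bar>)" .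
      qed
      also have "\<dots> = M * ((\<integral>x. \<bar>u n x * v n x\<bar> \<partial>lborel) + (\<integral>x. \<bar>f x * v n x\<bar> \<partial>lborel) + (\<integral>x. \<bar>u n x * g x\<bar> \<partial>lborel))"
        using i1 by simp
      also have "\<dots> \<le> M * (N (u n) * N (v n) + N f * N (v n) + N (u n) * N g)"
        unfolding N_def by (intro mult_left_mono add_mono L2fun_Cauchy_Schwarz uv L M0)
      finally show "norm ((\<integral>x. F n x * G n x * b x \<partial>lborel) - (\<integral>x. f x * g x * b x \<partial>lborel))
        \<le> M * (N (u n) * N (v n) + N f * N (v n) + N (u n) * N g)" .
    qed
    have "(\<lambda>n. M * (N (u n) * N (v n) + N f * N (v n) + N (u n) * N g)) \<longlonglongrightarrow> M * (0 * 0 + N f * 0 + 0 * N g)"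
      by (intro tendsto_intros u0 v0)
    then show "(\<lambda>n. M * (N (u n) * N (v n) + N f * N (v n) + N (u n) * N g)) \<longlonglongrightarrow> 0"
      by simp
  qed
  then show ?thesis by (simp add: LIM_zero_iff)
qed

section \<open>Compactly supported kernels, convolution and directional derivatives\<close>

definition compact_cont :: "('a::euclidean_space \<Rightarrow> real) \<Rightarrow> bool" where
  "compact_cont k \<longleftrightarrow> continuous_on UNIV k \<and> (\<exists>r. \<forall>z. norm z > r \<longrightarrow> k z = 0)"

lemma compact_cont_measurable [measurable_dest]: "compact_cont k \<Longrightarrow> k \<in> borel_measurable borel"
  by (auto simp: compact_cont_def intro: borel_measurable_continuous_onI)

lemma compact_contE:
  assumes "compact_cont k"
  obtains r B where "0 < r" "\<And>z. norm z > r \<Longrightarrow> k z = 0" "0 < B" "\<And>z. \<bar>k z\<bar> \<le> B"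
proof -
  obtain r where r: "\<And>z. norm z > r \<Longrightarrow> k z = 0" "continuous_on UNIV k"
    using assms by (auto simp: compact_cont_def)
  have "bounded (k ` cball 0 (max r 1))"
    by (intro compact_imp_bounded compact_continuous_image continuous_on_subset[OF r(2)]) auto
  then obtain B where B: "B > 0" "\<And>z. z \<in> cball 0 (max r 1) \<Longrightarrow> norm (k z) \<le> B"
    unfolding bounded_pos by blast
  have "\<bar>k z\<bar> \<le> B" for z
    using B(2)[of z] r(1)[of z] B(1) by (cases "norm z \<le> max r 1") auto
  with B(1) r(1) show ?thesis by (intro that[of "max r 1" B]) auto
qed

lemma integrable_indicator_cball: "integrable lborel (indicator (cball (c::'a::euclidean_space) r) :: 'a \<Rightarrow> real)"
  using emeasure_lborel_cball_finite[of c r] by simp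

lemma compact_cont_integrable:
  assumes "compact_cont k"
  shows "integrable lborel k"
proof -
  obtain r B where r: "0 < r" "\<And>z. norm z > r \<Longrightarrow> k z = 0" "0 < B" "\<And>z. \<bar>k z\<bar> \<le> B"
    by (rule compact_contE[OF assms], rule that)
  show ?thesis
  proof (rule Bochner_Integration.integrable_bound)
    show "integrable lborel (\<lambda>z. B * indicator (cball (0::'a) r) z)"
      by (intro integrable_mult_right integrable_indicator_cball)
    show "k \<in> borel_measurable lborel" using compact_cont_measurable[OF assms] by simp
    show "AE x in lborel. norm (k x) \<le> norm (B * indicator (cball 0 r) x)"
      using r by (auto simp: indicator_def)
  qed
qed

lemma compact_cont_mult_left:
  assumes "compact_cont k" "continuous_on UNIV g"
  shows "compact_cont (\<lambda>x. g x * k x)"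
  using assms unfolding compact_cont_def by (auto intro!: continuous_intros)

lemma compact_cont_L2fun: "compact_cont k \<Longrightarrow> L2fun k"
  using compact_cont_integrable[OF compact_cont_mult_left[of k k]]
  by (simp add: L2fun_def compact_cont_measurable power2_eq_square compact_cont_def)

lemma compact_cont_affine:
  assumes "compact_cont k" "c \<noteq> 0"
  shows "compact_cont (\<lambda>x. k (t + c *\<^sub>R x))"
proof -
  obtain r where r: "\<And>z. norm z > r \<Longrightarrow> k z = 0" "continuous_on UNIV k"
    using assms by (auto simp: compact_cont_def)
  have "k (t + c *\<^sub>R x) = 0" if "norm x > (\<bar>r\<bar> + norm t) / \<bar>c\<bar>" for x
  proof (rule r(1))
    have "\<bar>r\<bar> + norm t < norm (c *\<^sub>R x)"
      using that assms(2) by (simp add: field_simps)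
    also have "norm (c *\<^sub>R x) \<le> norm (t + c *\<^sub>R x) + norm t"
      using norm_triangle_ineq4[of "t + c *\<^sub>R x" t] by simp
    finally show "r < norm (t + c *\<^sub>R x)" by linarith
  qed
  moreover have "continuous_on UNIV (\<lambda>x. k (t + c *\<^sub>R x))"
    by (rule continuous_on_compose2[OF r(2)]) (auto intro!: continuous_intros)
  ultimately show ?thesis unfolding compact_cont_def by blast
qed

lemma compact_cont_reflect: "compact_cont k \<Longrightarrow> compact_cont (\<lambda>w. k (z - w))"
  using compact_cont_affine[of k "-1" z] by simp

definition convolve :: "('a::euclidean_space \<Rightarrow> real) \<Rightarrow> ('a \<Rightarrow> real) \<Rightarrow> 'a \<Rightarrow> real" where
  "convolve k f z = (\<integral>w. k (z - w) * f w \<partial>lborel)"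

lemma convolve_integrable: "compact_cont k \<Longrightarrow> L2fun f \<Longrightarrow> integrable lborel (\<lambda>w. k (z - w) * f w)"
  using L2fun_mult_integrable[OF compact_cont_L2fun[OF compact_cont_reflect[of k z]], of f] by simp

text \<open>A square integrable function need not be integrable, but its restriction to a ball is,
  being a product of two L2 functions. This is the majorant for both the continuity and the
  differentiability of convolutions.\<close>

lemma convolve_dominating: "L2fun f \<Longrightarrow> integrable lborel (\<lambda>w. B * (indicator (cball 0 r) w * \<bar>f w\<bar>))"
proof (intro integrable_mult_right L2fun_mult_integrable)
  show "L2fun (indicator (cball 0 r))"
    using integrable_indicator_cball[of 0 r]
    by (auto simp: L2fun_def power2_eq_square simp flip: indicator_inter_arith)
  show "L2fun f \<Longrightarrow> L2fun (\<lambda>w. \<bar>f w\<bar>)" by (auto simp: L2fun_def intro: borel_measurable_abs)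
qed

lemma convolve_continuous:
  assumes k: "compact_cont k" and f: "L2fun f"
  shows "continuous_on UNIV (convolve k f)"
proof -
  obtain r B where r: "0 < r" "\<And>z. norm z > r \<Longrightarrow> k z = 0" "0 < B" "\<And>z. \<bar>k z\<bar> \<le> B"
    by (rule compact_contE[OF k], rule that)
  note [measurable] = L2fun_measurable[OF f] compact_cont_measurable[OF k]
  have "(\<lambda>n. convolve k f (s n)) \<longlonglongrightarrow> convolve k f z" if s: "s \<longlonglongrightarrow> z" for s z
  proof -
    \<comment> \<open>A convergent sequence is bounded, so all the shifted kernels live in one ball
      of radius \<open>r + R\<close> and share a majorant.\<close>
    obtain R where R: "\<And>n. norm (s n) \<le> R"
      using convergent_imp_Bseq[OF convergentI[OF s]] by (auto simp: Bseq_def)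
    show ?thesis
      unfolding convolve_def
    proof (rule integral_dominated_convergence)
      show "integrable lborel (\<lambda>w. B * (indicator (cball 0 (r + R)) w * \<bar>f w\<bar>))"
        by (rule convolve_dominating[OF f])
      show "AE w in lborel. (\<lambda>n. k (s n - w) * f w) \<longlonglongrightarrow> k (z - w) * f w"
      proof (rule AE_I2)
        fix w
        have "isCont k (z - w)" using k by (simp add: compact_cont_def continuous_on_eq_continuous_at)
        then show "(\<lambda>n. k (s n - w) * f w) \<longlonglongrightarrow> k (z - w) * f w"
          by (intro tendsto_intros isCont_tendsto_compose[of _ k] s)
      qed
      show "AE w in lborel. norm (k (s n - w) * f w) \<le> B * (indicator (cball 0 (r + R)) w * \<bar>f w\<bar>)" for n
      proof (rule AE_I2)
        fix w
        show "norm (k (s n - w) * f w) \<le> B * (indicator (cball 0 (r + R)) w * \<bar>f w\<bar>)"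
        proof (cases "norm w \<le> r + R")
          case True
          then show ?thesis using r(4) by (simp add: abs_mult mult_right_mono)
        next
          case False
          then have "norm (s n - w) > r" using R[of n] norm_triangle_ineq2[of w "s n"]
            by (simp add: norm_minus_commute)
          then show ?thesis using r(2) r(3) by simp
        qed
      qed
    qed measurable
  qed
  then show ?thesis
    by (auto simp: continuous_on_eq_continuous_at continuous_at_sequentially o_def)
qed

text \<open>C1 along a single direction. The derivative is asked only at s = 0, but for every base
  point, which covers the whole line. Continuity is joint in all variables, so both functions are
  Borel. The notion fits smooth functions, convolutions and squared positive parts alike.\<close>

definition dir_deriv :: "'a::euclidean_space \<Rightarrow> ('a \<Rightarrow> real) \<Rightarrow> ('a \<Rightarrow> real) \<Rightarrow> bool" where
  "dir_deriv v f f' \<longleftrightarrow> continuous_on UNIV f \<and> continuous_on UNIV f' \<and>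
     (\<forall>z. ((\<lambda>s. f (z + s *\<^sub>R v)) has_real_derivative f' z) (at 0))"

lemma dir_deriv_mult:
  assumes "dir_deriv v f f'" "dir_deriv v g g'"
  shows "dir_deriv v (\<lambda>z. f z * g z) (\<lambda>z. f' z * g z + f z * g' z)"
  using assms unfolding dir_deriv_def
  by (auto intro!: continuous_intros derivative_eq_intros)

lemma dir_deriv_at:
  assumes "dir_deriv v f f'"
  shows "((\<lambda>s. f (z + s *\<^sub>R v)) has_real_derivative f' (z + t *\<^sub>R v)) (at t)"
proof -
  have "((\<lambda>s. f ((z + t *\<^sub>R v) + s *\<^sub>R v)) has_real_derivative f' (z + t *\<^sub>R v)) (at (t + (- t)))"
    using assms by (simp add: dir_deriv_def)
  then have "((\<lambda>s. f ((z + t *\<^sub>R v) + (s + (- t)) *\<^sub>R v)) has_real_derivative f' (z + t *\<^sub>R v)) (at t)"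
    by (rule iffD1[OF DERIV_shift])
  then show ?thesis by (simp add: algebra_simps)
qed

lemma dir_deriv_diff_bound:
  assumes "dir_deriv v f f'" "\<And>z. \<bar>f' z\<bar> \<le> B"
  shows "\<bar>f (z + h *\<^sub>R v) - f z\<bar> \<le> B * \<bar>h\<bar>"
proof -
  have "norm (f (z + h *\<^sub>R v) - f (z + 0 *\<^sub>R v)) \<le> B * norm (h - 0)"
    by (rule field_differentiable_bound[where S = UNIV and f' = "\<lambda>t. f' (z + t *\<^sub>R v)"])
      (use assms in \<open>auto intro: dir_deriv_at\<close>)
  then show ?thesis by simp
qed

lemma dir_deriv_tendsto:
  assumes "dir_deriv v f f'" "h \<longlonglongrightarrow> 0" "\<And>n. h n \<noteq> 0"
  shows "(\<lambda>n. (f (z + h n *\<^sub>R v) - f z) / h n) \<longlonglongrightarrow> f' z"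
proof -
  have "((\<lambda>s. (f (z + s *\<^sub>R v) - f z) / s) \<longlongrightarrow> f' z) (at 0)"
    using assms(1) by (simp add: dir_deriv_def DERIV_def)
  then show ?thesis
    by (rule filterlim_compose) (use assms in \<open>auto simp: filterlim_at\<close>)
qed

lemma dir_deriv_zero:
  assumes "dir_deriv v f f'" "\<And>z. norm z > r \<Longrightarrow> f z = 0"
  shows "norm z > r \<Longrightarrow> f' z = 0"
proof -
  assume z: "norm z > r"
  have "open {s::real. norm (z + s *\<^sub>R v) > r}"
    by (intro open_Collect_less continuous_intros)
  then have "((\<lambda>s. f (z + s *\<^sub>R v)) has_real_derivative f' z) (at 0) \<longleftrightarrow>
      ((\<lambda>s. 0) has_real_derivative f' z) (at (0::real))"
    by (intro DERIV_cong_ev refl eventually_nhds[THEN iffD2] exI[of _ "{s. norm (z + s *\<^sub>R v) > r}"])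
      (use z assms(2) in auto)
  then have "((\<lambda>s::real. 0::real) has_real_derivative f' z) (at 0)"
    using assms(1) by (auto simp: dir_deriv_def)
  then show "f' z = 0" using DERIV_unique DERIV_const by blast
qed

lemma dir_deriv_compact_cont:
  assumes "dir_deriv v f f'" "compact_cont f"
  shows "compact_cont f'"
  using assms dir_deriv_zero[OF assms(1)] unfolding compact_cont_def unfolding dir_deriv_def by blast

text \<open>The derivative falls on the kernel, so \<open>f\<close> needs no regularity. The
  difference quotients of \<open>k\<close> converge pointwise and, by the mean value inequality, are
  bounded by the supremum of the derivative.\<close>

lemma convolve_dir_deriv:
  assumes k: "compact_cont k" and d: "dir_deriv v k k'" and f: "L2fun f"
  shows "dir_deriv v (convolve k f) (convolve k' f)"
  unfolding dir_deriv_def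
proof (intro conjI allI)
  have k': "compact_cont k'" by (rule dir_deriv_compact_cont[OF d k])
  show "continuous_on UNIV (convolve k f)" "continuous_on UNIV (convolve k' f)"
    by (rule convolve_continuous[OF k f], rule convolve_continuous[OF k' f])
  obtain r where r: "\<And>z. norm z > r \<Longrightarrow> k z = 0"
    using k unfolding compact_cont_def by blast
  obtain B where B: "0 < B" "\<And>z. \<bar>k' z\<bar> \<le> B"
    by (rule compact_contE[OF k'], rule that)
  note [measurable] = L2fun_measurable[OF f] compact_cont_measurable[OF k] compact_cont_measurable[OF k']
  fix z
  have "(\<lambda>n. (convolve k f (z + h n *\<^sub>R v) - convolve k f z) / h n) \<longlonglongrightarrow> convolve k' f z"
    if h: "\<And>n. h n \<noteq> 0" "h \<longlonglongrightarrow> 0" for h :: "nat \<Rightarrow> real"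
  proof -
    obtain H where H: "\<And>n. \<bar>h n\<bar> \<le> H"
      using convergent_imp_Bseq[OF convergentI[OF h(2)]] by (auto simp: Bseq_def)
    have eq: "(convolve k f (z + h n *\<^sub>R v) - convolve k f z) / h n =
        (\<integral>w. (k (z + h n *\<^sub>R v - w) - k (z - w)) / h n * f w \<partial>lborel)" for n
      unfolding convolve_def
      by (subst Bochner_Integration.integral_diff[symmetric])
        (simp_all add: convolve_integrable k f left_diff_distrib flip: integral_divide_zero)
    have "(\<lambda>n. \<integral>w. (k (z + h n *\<^sub>R v - w) - k (z - w)) / h n * f w \<partial>lborel) \<longlonglongrightarrow> convolve k' f z"
      unfolding convolve_def
    proof (rule integral_dominated_convergence)
      \<comment> \<open>The term \<open>H * norm v\<close> leaves room for the largest shift: if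
        \<open>norm w > R\<close>, both arguments of \<open>k\<close> have norm above
        \<open>r\<close> and the quotient is 0.\<close>
      define R where "R = r + norm z + H * norm v"
      show "integrable lborel (\<lambda>w. B * (indicator (cball 0 R) w * \<bar>f w\<bar>))"
        by (rule convolve_dominating[OF f])
      show "AE w in lborel. (\<lambda>n. (k (z + h n *\<^sub>R v - w) - k (z - w)) / h n * f w) \<longlonglongrightarrow> k' (z - w) * f w"
      proof (rule AE_I2)
        fix w
        show "(\<lambda>n. (k (z + h n *\<^sub>R v - w) - k (z - w)) / h n * f w) \<longlonglongrightarrow> k' (z - w) * f w"
          using dir_deriv_tendsto[OF d h(2,1), of "z - w"]
          by (intro tendsto_intros) (simp add: algebra_simps)
      qed
      show "AE w in lborel. norm ((k (z + h n *\<^sub>R v - w) - k (z - w)) / h n * f w)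
          \<le> B * (indicator (cball 0 R) w * \<bar>f w\<bar>)" for n
      proof (rule AE_I2)
        fix w
        show "norm ((k (z + h n *\<^sub>R v - w) - k (z - w)) / h n * f w)
          \<le> B * (indicator (cball 0 R) w * \<bar>f w\<bar>)"
        proof (cases "norm w \<le> R")
          case True
          have "\<bar>k ((z - w) + h n *\<^sub>R v) - k (z - w)\<bar> \<le> B * \<bar>h n\<bar>"
            by (rule dir_deriv_diff_bound[OF d B(2)])
          then have "\<bar>(k (z + h n *\<^sub>R v - w) - k (z - w)) / h n\<bar> \<le> B"
            using h(1)[of n] by (simp add: field_simps)
          then have "\<bar>(k (z + h n *\<^sub>R v - w) - k (z - w)) / h n\<bar> * \<bar>f w\<bar> \<le> B * \<bar>f w\<bar>"
            by (rule mult_right_mono) simp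
          then show ?thesis using True by (simp add: abs_mult)
        next
          case False
          have 1: "norm (h n *\<^sub>R v) \<le> H * norm v" using H[of n] by (simp add: mult_right_mono)
          have 2: "0 \<le> H * norm v" using H[of 0] by (intro mult_nonneg_nonneg) auto
          have "norm w \<le> norm (z + h n *\<^sub>R v - w) + norm (z + h n *\<^sub>R v)"
            using norm_triangle_ineq4[of "z + h n *\<^sub>R v" "z + h n *\<^sub>R v - w"] by simp
          also have "norm (z + h n *\<^sub>R v) \<le> norm z + H * norm v"
            using 1 norm_triangle_ineq[of z "h n *\<^sub>R v"] by linarith
          finally have 3: "norm (z + h n *\<^sub>R v - w) > r" using False by (simp add: R_def)
          have "norm w \<le> norm (z - w) + norm z"
            using norm_triangle_ineq4[of z "z - w"] by simp
          then have "norm (z - w) > r" using False 2 by (simp add: R_def)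
          then show ?thesis using 3 r B(1) by simp
        qed
      qed
    qed measurable
    then show ?thesis by (simp add: eq)
  qed
  then show "((\<lambda>s. convolve k f (z + s *\<^sub>R v)) has_real_derivative convolve k' f z) (at 0)"
    by (auto simp: DERIV_def tendsto_at_iff_sequentially o_def)
qed

text \<open>Translation invariance of Lebesgue measure makes the integral of every difference
  quotient 0, and dominated convergence carries this to the derivative. No coordinates or iterated
  integrals are involved, so \<open>v\<close> may be any vector.\<close>

lemma integral_dir_deriv_zero:
  assumes d: "dir_deriv v f f'" and f: "compact_cont f"
  shows "(\<integral>z. f' z \<partial>lborel) = 0"
proof -
  have f': "compact_cont f'" by (rule dir_deriv_compact_cont[OF d f])
  obtain r where r: "\<And>z. norm z > r \<Longrightarrow> f z = 0"
    using f unfolding compact_cont_def by blast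
  obtain B where B: "0 < B" "\<And>z. \<bar>f' z\<bar> \<le> B"
    by (rule compact_contE[OF f'], rule that)
  note [measurable] = compact_cont_measurable[OF f] compact_cont_measurable[OF f']
  define h where "h n = inverse (real (Suc n))" for n
  have h: "h \<longlonglongrightarrow> 0" "\<And>n. h n \<noteq> 0" "\<And>n. \<bar>h n\<bar> \<le> 1"
    unfolding h_def using LIMSEQ_inverse_real_of_nat by (auto simp: field_simps)
  have i: "integrable lborel (\<lambda>z. f (z + c))" for c
    using integrable_lborel_affine[OF compact_cont_integrable[OF f], of 1 c] by (simp add: add.commute)
  have "(\<integral>z. (f (z + h n *\<^sub>R v) - f z) / h n \<partial>lborel) = 0" for n
    using integral_lborel_plus[of f "h n *\<^sub>R v"] i[of "h n *\<^sub>R v"] compact_cont_integrable[OF f]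
    by simp
  moreover have "(\<lambda>n. \<integral>z. (f (z + h n *\<^sub>R v) - f z) / h n \<partial>lborel) \<longlonglongrightarrow> (\<integral>z. f' z \<partial>lborel)"
  proof (rule integral_dominated_convergence)
    define R where "R = r + norm v"
    show "integrable lborel (\<lambda>z. B * indicator (cball (0::'a) R) z)"
      by (intro integrable_mult_right integrable_indicator_cball)
    show "AE z in lborel. (\<lambda>n. (f (z + h n *\<^sub>R v) - f z) / h n) \<longlonglongrightarrow> f' z"
      by (intro AE_I2 dir_deriv_tendsto[OF d] h)
    show "AE z in lborel. norm ((f (z + h n *\<^sub>R v) - f z) / h n) \<le> B * indicator (cball 0 R) z" for n
    proof (rule AE_I2)
      fix z
      show "norm ((f (z + h n *\<^sub>R v) - f z) / h n) \<le> B * indicator (cball 0 R) z"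
      proof (cases "norm z \<le> R")
        case True
        then show ?thesis using dir_deriv_diff_bound[OF d B(2), of z "h n"] h(2)[of n]
          by (simp add: field_simps)
      next
        case False
        have "norm (h n *\<^sub>R v) \<le> norm v" using h(3)[of n] by (simp add: mult_left_le_one_le)
        then have "norm (z + h n *\<^sub>R v) > r"
          using False norm_triangle_ineq4[of "z + h n *\<^sub>R v" "h n *\<^sub>R v"] by (simp add: R_def)
        moreover have "norm z > r" using False by (simp add: R_def) (smt (verit) norm_ge_zero)
        ultimately show ?thesis using r B(1) by simp
      qed
    qed
  qed measurable
  ultimately show ?thesis by (simp add: LIMSEQ_const_iff del: integral_divide_zero)
qed

subsection \<open>Approximate identities\<close>

definition L1_shift_continuous :: "('a::euclidean_space \<Rightarrow> real) \<Rightarrow> bool" where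
  "L1_shift_continuous f \<longleftrightarrow>
     (\<forall>e>0. \<exists>d>0. \<forall>h. norm h < d \<longrightarrow> (\<integral>z. \<bar>f (z + h) - f z\<bar> \<partial>lborel) < e)"

lemma integrable_shift:
  fixes f :: "'a::euclidean_space \<Rightarrow> real"
  shows "integrable lborel f \<Longrightarrow> integrable lborel (\<lambda>z. f (z + h))"
  using integrable_lborel_affine[of f 1 h] by (simp add: add.commute)

text \<open>An estimate with three terms: approximate, shift the approximant, approximate back. The
  first and last term agree by translation invariance. The bound with the factor 2 is the one
  provided by \<open>integrable_induct\<close>, and it yields the majorant 3 |f|.\<close>

lemma L1_shift_continuous_lim:
  fixes f :: "'a::euclidean_space \<Rightarrow> real"
  assumes s: "\<And>i. integrable lborel (s i)" "\<And>i. L1_shift_continuous (s i)"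
    and lim: "\<And>x. (\<lambda>i. s i x) \<longlonglongrightarrow> f x" and bd: "\<And>i x. norm (s i x) \<le> 2 * norm (f x)"
    and f: "integrable lborel f"
  shows "L1_shift_continuous f"
  unfolding L1_shift_continuous_def
proof (intro allI impI)
  fix e :: real assume e: "e > 0"
  have [measurable]: "f \<in> borel_measurable borel" "s i \<in> borel_measurable borel" for i
    using f s(1)[of i] by (auto dest: borel_measurable_integrable)
  have "(\<lambda>i. \<integral>x. \<bar>s i x - f x\<bar> \<partial>lborel) \<longlonglongrightarrow> (\<integral>x. 0 \<partial>(lborel::'a measure))"
  proof (rule integral_dominated_convergence)
    show "integrable lborel (\<lambda>x. 3 * \<bar>f x\<bar>)" using f by simp
    show "AE x in lborel. (\<lambda>i. \<bar>s i x - f x\<bar>) \<longlonglongrightarrow> 0"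
      using lim by (auto intro!: tendsto_rabs_zero LIM_zero)
    have "\<bar>s i x - f x\<bar> \<le> 3 * \<bar>f x\<bar>" for i x
      using bd[of i x] abs_triangle_ineq4[of "s i x" "f x"] by simp
    then show "AE x in lborel. norm \<bar>s i x - f x\<bar> \<le> 3 * \<bar>f x\<bar>" for i by simp
  qed measurable
  then have "\<forall>\<^sub>F i in sequentially. (\<integral>x. \<bar>s i x - f x\<bar> \<partial>lborel) < e / 3"
    using e by (intro order_tendstoD(2)[of _ 0]) simp_all
  then obtain i where i: "(\<integral>x. \<bar>s i x - f x\<bar> \<partial>lborel) < e / 3"
    by (meson eventually_sequentially order_refl)
  obtain d where d: "d > 0" "\<And>h. norm h < d \<Longrightarrow> (\<integral>z. \<bar>s i (z + h) - s i z\<bar> \<partial>lborel) < e / 3"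
    using s(2)[of i] e unfolding L1_shift_continuous_def by (meson divide_pos_pos zero_less_numeral)
  show "\<exists>d>0. \<forall>h. norm h < d \<longrightarrow> (\<integral>z. \<bar>f (z + h) - f z\<bar> \<partial>lborel) < e"
  proof (intro exI[of _ d] conjI allI impI d(1))
    fix h :: 'a assume h: "norm h < d"
    have int: "integrable lborel (\<lambda>z. \<bar>s i (z + h) - f (z + h)\<bar>)" "integrable lborel (\<lambda>z. \<bar>s i (z + h) - s i z\<bar>)"
      "integrable lborel (\<lambda>z. \<bar>s i z - f z\<bar>)" "integrable lborel (\<lambda>z. \<bar>f (z + h) - f z\<bar>)"
      using s(1)[of i] f by (auto intro!: integrable_abs Bochner_Integration.integrable_diff integrable_shift)
    have "(\<integral>z. \<bar>f (z + h) - f z\<bar> \<partial>lborel)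
        \<le> (\<integral>z. \<bar>s i (z + h) - f (z + h)\<bar> + \<bar>s i (z + h) - s i z\<bar> + \<bar>s i z - f z\<bar> \<partial>lborel)"
      using int by (intro integral_mono) auto
    also have "\<dots> = (\<integral>z. \<bar>s i (z + h) - f (z + h)\<bar> \<partial>lborel) + (\<integral>z. \<bar>s i (z + h) - s i z\<bar> \<partial>lborel)
        + (\<integral>z. \<bar>s i z - f z\<bar> \<partial>lborel)"
      using int by simp
    also have "(\<integral>z. \<bar>s i (z + h) - f (z + h)\<bar> \<partial>lborel) = (\<integral>z. \<bar>s i z - f z\<bar> \<partial>lborel)"
      by (rule integral_lborel_plus[of "\<lambda>z. \<bar>s i z - f z\<bar>"]) measurable
    finally show "(\<integral>z. \<bar>f (z + h) - f z\<bar> \<partial>lborel) < e"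
      using i d(2)[OF h] by linarith
  qed
qed

text \<open>Outer regularity of \<open>A\<close> and of its complement gives
  \<open>- V \<subseteq> A \<subseteq> U\<close> with \<open>U\<close> and \<open>V\<close> open.
  The closed set \<open>- V\<close> is compact because \<open>A\<close> is bounded, so it has a
  positive distance \<open>d\<close> from the complement of \<open>U\<close>. If a shift shorter
  than \<open>d\<close> moves a point into or out of \<open>A\<close>, then one of its two ends lies
  in the small set \<open>W\<close>.\<close>

lemma L1_shift_continuous_bounded:
  fixes A :: "'a::euclidean_space set"
  assumes A: "A \<in> sets borel" "bounded A"
  shows "L1_shift_continuous (indicator A)"
  unfolding L1_shift_continuous_def
proof (intro allI impI)
  fix e :: real assume e: "e > 0"
  \<comment> \<open>\<open>W\<close> consists of two pieces and is integrated twice, once shifted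
    and once not; hence a quarter of \<open>e\<close> for each piece.\<close>
  obtain U where U: "open U" "A \<subseteq> U" "emeasure lborel (U - A) < ennreal (e / 4)"
    using outer_regular_lborel[OF A(1), of "e / 4"] e by auto
  obtain V where V: "open V" "- A \<subseteq> V" "emeasure lborel (V - (- A)) < ennreal (e / 4)"
    using outer_regular_lborel[of "- A" "e / 4"] A(1) e by auto
  define W where "W = (U - A) \<union> (V - (- A))"
  have Wm: "W \<in> sets borel" using A U V by (auto simp: W_def)
  have "emeasure lborel W \<le> emeasure lborel (U - A) + emeasure lborel (V - (- A))"
    unfolding W_def using A U V by (intro emeasure_subadditive) auto
  also have "\<dots> < ennreal (e / 4) + ennreal (e / 4)"
    using U(3) V(3) by (rule add_strict_mono)
  also have "\<dots> = ennreal (e / 2)" using e by (simp flip: ennreal_plus)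
  finally have We: "emeasure lborel W < ennreal (e / 2)" .
  have Wfin: "emeasure lborel W < \<infinity>" using order.strict_trans[OF We ennreal_less_top] by simp
  have We': "(\<integral>z. indicator W z \<partial>lborel) < e / 2"
  proof -
    have "emeasure lborel W = ennreal (measure lborel W)"
      using Wfin by (intro emeasure_eq_ennreal_measure) auto
    with We have "measure lborel W < e / 2" by (simp add: ennreal_less_iff)
    then show ?thesis using Wm by simp
  qed
  have K: "compact (- V)" "- V \<subseteq> U"
    using V U A(2) bounded_subset[of A "- V"] by (auto simp: compact_eq_bounded_closed)
  have "closed (- U)" "- V \<inter> - U = {}" using U K by auto
  then obtain d where d: "d > 0" "\<And>x y. x \<in> - V \<Longrightarrow> y \<in> - U \<Longrightarrow> d \<le> dist x y"
    using separate_compact_closed[OF K(1)] by (metis disjoint_iff)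
  show "\<exists>d>0. \<forall>h. norm h < d \<longrightarrow> (\<integral>z. \<bar>indicator A (z + h) - indicator A z\<bar> \<partial>lborel) < e"
  proof (intro exI[of _ d] conjI allI impI d(1))
    fix h :: 'a assume h: "norm h < d"
    have iW: "integrable lborel (indicator W :: 'a \<Rightarrow> real)"
      using Wm Wfin by simp
    have shift: "y \<in> U" if "x \<in> - V" "y = x + h \<or> x = y + h" for x y
    proof (rule ccontr)
      assume "y \<notin> U"
      then have "d \<le> dist x y" using d(2) that(1) by simp
      moreover have "dist x y = norm h" using that(2) by (auto simp: dist_norm)
      ultimately show False using h by simp
    qed
    have pt: "\<bar>indicator A (z + h) - indicator A z\<bar> \<le> (indicator W (z + h) + indicator W z :: real)" for z
    proof (cases "z \<in> A \<longleftrightarrow> z + h \<in> A")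
      case False
      then have "z \<in> W \<or> z + h \<in> W"
        using shift[of z "z + h"] shift[of "z + h" z] unfolding W_def by auto
      then show ?thesis by (auto simp: indicator_def)
    qed (auto simp: indicator_def)
    have "(\<integral>z. \<bar>indicat_real A (z + h) - indicat_real A z\<bar> \<partial>lborel)
        \<le> (\<integral>z. indicat_real W (z + h) + indicat_real W z \<partial>lborel)"
      using iW integrable_shift[OF iW, of h] pt
      by (intro integral_mono') auto
    also have "\<dots> = (\<integral>z. indicat_real W (z + h) \<partial>lborel) + (\<integral>z. indicat_real W z \<partial>lborel)"
      using iW integrable_shift[OF iW, of h] by (rule Bochner_Integration.integral_add[rotated])
    also have "(\<integral>z. indicat_real W (z + h) \<partial>lborel) = (\<integral>z. indicat_real W z \<partial>lborel)"
      using Wm by (intro integral_lborel_plus) auto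
    finally show "(\<integral>z. \<bar>indicat_real A (z + h) - indicat_real A z\<bar> \<partial>lborel) < e"
      using We' by linarith
  qed
qed

lemma L1_shift_continuous_cmult:
  assumes "L1_shift_continuous f"
  shows "L1_shift_continuous (\<lambda>z. c * f z)"
  unfolding L1_shift_continuous_def
proof (intro allI impI)
  fix e :: real assume e: "e > 0"
  obtain d where d: "d > 0" "\<And>h. norm h < d \<Longrightarrow> (\<integral>z. \<bar>f (z + h) - f z\<bar> \<partial>lborel) < e / (\<bar>c\<bar> + 1)"
    using assms e unfolding L1_shift_continuous_def
    by (metis abs_ge_zero add_nonneg_pos divide_pos_pos zero_less_one)
  show "\<exists>d>0. \<forall>h. norm h < d \<longrightarrow> (\<integral>z. \<bar>c * f (z + h) - c * f z\<bar> \<partial>lborel) < e"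
  proof (intro exI[of _ d] conjI allI impI d(1))
    fix h :: 'a assume h: "norm h < d"
    define I where "I = (\<integral>z. \<bar>f (z + h) - f z\<bar> \<partial>lborel)"
    have "0 \<le> I" unfolding I_def by simp
    have "I * (\<bar>c\<bar> + 1) < e" using d(2)[OF h] unfolding I_def[symmetric] by (simp add: pos_less_divide_eq)
    have "(\<integral>z. \<bar>c * f (z + h) - c * f z\<bar> \<partial>lborel) = \<bar>c\<bar> * I"
      unfolding I_def by (simp add: abs_mult flip: right_diff_distrib)
    also have "\<dots> \<le> I * (\<bar>c\<bar> + 1)" using \<open>0 \<le> I\<close> by (simp add: algebra_simps)
    also have "\<dots> < e" by fact
    finally show "(\<integral>z. \<bar>c * f (z + h) - c * f z\<bar> \<partial>lborel) < e" .
  qed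
qed

text \<open>A set of finite measure is the limit of its intersections with balls, which are bounded;
  sums and pointwise limits then reach every integrable function.\<close>

lemma integrable_L1_shift_continuous:
  fixes f :: "'a::euclidean_space \<Rightarrow> real"
  assumes "integrable lborel f"
  shows "L1_shift_continuous f"
  using assms
proof (induction rule: integrable_induct)
  case (base A c)
  have Am: "A \<in> sets borel" using base by simp
  have "L1_shift_continuous (indicator A :: 'a \<Rightarrow> real)"
  proof (rule L1_shift_continuous_lim)
    show "integrable lborel (indicator (A \<inter> cball 0 (real i)) :: 'a \<Rightarrow> real)" for i
      using base order.strict_trans1[OF emeasure_mono[of "A \<inter> cball 0 (real i)" A lborel]] by auto
    show "L1_shift_continuous (indicator (A \<inter> cball 0 (real i)) :: 'a \<Rightarrow> real)" for i
      using Am by (intro L1_shift_continuous_bounded) auto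
    show "(\<lambda>i. indicator (A \<inter> cball 0 (real i)) x) \<longlonglongrightarrow> (indicator A x :: real)" for x
    proof (rule tendsto_eventually)
      obtain k where "norm x \<le> real k" using real_arch_simple by blast
      then show "\<forall>\<^sub>F i in sequentially. indicator (A \<inter> cball 0 (real i)) x = (indicator A x :: real)"
        by (intro eventually_sequentiallyI[of k]) (auto simp: indicator_def)
    qed
    show "norm (indicator (A \<inter> cball 0 (real i)) x :: real) \<le> 2 * norm (indicator A x :: real)" for i x
      by (auto simp: indicator_def)
    show "integrable lborel (indicator A :: 'a \<Rightarrow> real)" using base by simp
  qed
  then show ?case using L1_shift_continuous_cmult[of "indicator A" c] by (simp add: mult.commute)
next
  case (add f g)
  show ?case unfolding L1_shift_continuous_def
  proof (intro allI impI)
    fix e :: real assume e: "e > 0"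
    obtain d1 where d1: "d1 > 0" "\<And>h. norm h < d1 \<Longrightarrow> (\<integral>z. \<bar>f (z + h) - f z\<bar> \<partial>lborel) < e / 2"
      using add(3) e unfolding L1_shift_continuous_def by (meson half_gt_zero)
    obtain d2 where d2: "d2 > 0" "\<And>h. norm h < d2 \<Longrightarrow> (\<integral>z. \<bar>g (z + h) - g z\<bar> \<partial>lborel) < e / 2"
      using add(4) e unfolding L1_shift_continuous_def by (meson half_gt_zero)
    show "\<exists>d>0. \<forall>h. norm h < d \<longrightarrow> (\<integral>z. \<bar>f (z + h) + g (z + h) - (f z + g z)\<bar> \<partial>lborel) < e"
    proof (intro exI[of _ "min d1 d2"] conjI allI impI)
      show "0 < min d1 d2" using d1 d2 by simp
      fix h :: 'a assume h: "norm h < min d1 d2"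
      have int: "integrable lborel (\<lambda>z. \<bar>f (z + h) - f z\<bar>)" "integrable lborel (\<lambda>z. \<bar>g (z + h) - g z\<bar>)"
        using add(1,2) by (auto intro!: integrable_abs Bochner_Integration.integrable_diff integrable_shift)
      have "(\<integral>z. \<bar>f (z + h) + g (z + h) - (f z + g z)\<bar> \<partial>lborel)
          \<le> (\<integral>z. \<bar>f (z + h) - f z\<bar> + \<bar>g (z + h) - g z\<bar> \<partial>lborel)"
        using int by (intro integral_mono') auto
      also have "\<dots> = (\<integral>z. \<bar>f (z + h) - f z\<bar> \<partial>lborel) + (\<integral>z. \<bar>g (z + h) - g z\<bar> \<partial>lborel)"
        using int by simp
      finally show "(\<integral>z. \<bar>f (z + h) + g (z + h) - (f z + g z)\<bar> \<partial>lborel) < e"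
        using d1(2)[of h] d2(2)[of h] h by simp
    qed
  qed
next
  case (lim f s)
  then show ?case by (intro L1_shift_continuous_lim[of s f]) auto
qed

text \<open>Reduces continuity of translations in \<open>L\<^sup>2\<close> at \<open>f\<close> to that in \<open>L\<^sup>1\<close> at \<open>f \<bar>f\<bar>\<close>.\<close>

lemma square_diff_le_signed_squares:
  fixes a b :: real
  shows "(a - b)\<^sup>2 \<le> 2 * \<bar>a * \<bar>a\<bar> - b * \<bar>b\<bar>\<bar>"
proof -
  have same: "(x - y)\<^sup>2 \<le> 2 * \<bar>x\<^sup>2 - y\<^sup>2\<bar>" if "x \<ge> 0" "y \<ge> 0" for x y :: real
  proof -
    have "(x - y)\<^sup>2 = \<bar>x - y\<bar> * \<bar>x - y\<bar>" by (simp add: power2_eq_square)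
    also have "\<dots> \<le> \<bar>x - y\<bar> * \<bar>x + y\<bar>" using that by (intro mult_left_mono) auto
    also have "\<dots> = \<bar>x\<^sup>2 - y\<^sup>2\<bar>" by (simp add: power2_eq_square algebra_simps flip: abs_mult)
    finally show ?thesis by (rule order_trans) simp
  qed
  have opp: "(x + y)\<^sup>2 \<le> 2 * (x\<^sup>2 + y\<^sup>2)" for x y :: real
    using zero_le_power2[of "x - y"] by (simp add: power2_eq_square algebra_simps)
  consider "a \<ge> 0" "b \<ge> 0" | "a < 0" "b < 0" | "a \<ge> 0" "b < 0" | "a < 0" "b \<ge> 0" by linarith
  then show ?thesis
  proof cases
    case 1 then show ?thesis using same[of a b] by (simp add: power2_eq_square)
  next
    case 2 then show ?thesis using same[of "-a" "-b"] by (simp add: power2_eq_square algebra_simps abs_minus_commute)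
  next
    case 3
    then have "a * \<bar>a\<bar> - b * \<bar>b\<bar> = a\<^sup>2 + (-b)\<^sup>2" by (simp add: power2_eq_square)
    then show ?thesis using opp[of a "-b"] by simp
  next
    case 4
    then have "a * \<bar>a\<bar> - b * \<bar>b\<bar> = - ((-a)\<^sup>2 + b\<^sup>2)" by (simp add: power2_eq_square)
    then show ?thesis using opp[of "-a" b] by (simp add: power2_commute)
  qed
qed

lemma L2fun_shift: "L2fun f \<Longrightarrow> L2fun (\<lambda>z. f (z + h))"
  using integrable_shift[of "\<lambda>z. (f z)\<^sup>2" h] unfolding L2fun_def
  by (auto intro: measurable_compose[of "\<lambda>z. z + h" borel borel])

lemma L2fun_shift_continuous:
  fixes f :: "'a::euclidean_space \<Rightarrow> real"
  assumes f: "L2fun f" and e: "e > 0"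
  shows "\<exists>d>0. \<forall>h. norm h < d \<longrightarrow> (\<integral>z. (f (z + h) - f z)\<^sup>2 \<partial>lborel) \<le> e"
proof -
  define F where "F z = f z * \<bar>f z\<bar>" for z
  have F: "integrable lborel F" unfolding F_def
    by (rule L2fun_mult_integrable[OF f])
      (use f in \<open>auto simp: L2fun_def intro: borel_measurable_abs\<close>)
  obtain d where d: "d > 0" "\<And>h. norm h < d \<Longrightarrow> (\<integral>z. \<bar>F (z + h) - F z\<bar> \<partial>lborel) < e / 2"
    using integrable_L1_shift_continuous[OF F] e unfolding L1_shift_continuous_def by (meson half_gt_zero)
  have "(\<integral>z. (f (z + h) - f z)\<^sup>2 \<partial>lborel) \<le> e" if h: "norm h < d" for h
  proof -
    have "(\<integral>z. (f (z + h) - f z)\<^sup>2 \<partial>lborel) \<le> (\<integral>z. 2 * \<bar>F (z + h) - F z\<bar> \<partial>lborel)"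
    proof (rule integral_mono')
      show "integrable lborel (\<lambda>z. 2 * \<bar>F (z + h) - F z\<bar>)"
        using F integrable_shift[OF F] by auto
    qed (auto simp: F_def square_diff_le_signed_squares)
    then show ?thesis using d(2)[OF h] by simp
  qed
  with d(1) show ?thesis by blast
qed

text \<open>The substitution w to z - w passes between the form that lets derivatives fall on the
  kernel and the form that compares \<open>f\<close> with its translates.\<close>

lemma convolve_eq_shift:
  fixes f :: "'a::euclidean_space \<Rightarrow> real"
  assumes k: "compact_cont k" and f: "L2fun f"
  shows "integrable lborel (\<lambda>w. k w * f (z - w))" "convolve k f z = (\<integral>w. k w * f (z - w) \<partial>lborel)"
proof -
  note [measurable] = L2fun_measurable[OF f] compact_cont_measurable[OF k]
  show "integrable lborel (\<lambda>w. k w * f (z - w))"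
    using integrable_lborel_affine[OF convolve_integrable[OF k f, of z], of "-1" z] by simp
  show "convolve k f z = (\<integral>w. k w * f (z - w) \<partial>lborel)"
    unfolding convolve_def by (subst integral_lborel_affine[of _ "-1" z]) auto
qed

text \<open>The difference is the average of f(z - w) - f(z) with weight k(w). Writing |k| as the
  square of sqrt |k| in Cauchy-Schwarz bounds its square by K times the average of |f(z - w) -
  f(z)|^2 with weight |k|, and Tonelli moves the z-integral inside. Nonnegative integrals are used
  because square integrability of the left side is to be derived from this bound.\<close>

lemma convolve_L2_bound:
  fixes f :: "'a::euclidean_space \<Rightarrow> real"
  assumes k: "compact_cont k" and f: "L2fun f"
    and E: "\<And>w. k w \<noteq> 0 \<Longrightarrow> (\<integral>z. (f (z - w) - f z)\<^sup>2 \<partial>lborel) \<le> E"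
  shows "(\<integral>\<^sup>+z. ennreal ((convolve k f z - (\<integral>w. k w \<partial>lborel) * f z)\<^sup>2) \<partial>lborel)
    \<le> ennreal ((\<integral>w. \<bar>k w\<bar> \<partial>lborel)\<^sup>2 * E)"
proof -
  note [measurable] = L2fun_measurable[OF f] compact_cont_measurable[OF k]
  define K where "K = (\<integral>w. \<bar>k w\<bar> \<partial>lborel)"
  have K0: "K \<ge> 0" unfolding K_def by simp
  have nK: "(\<integral>\<^sup>+w. ennreal \<bar>k w\<bar> \<partial>lborel) = ennreal K"
    unfolding K_def using compact_cont_integrable[OF k] by (intro nn_integral_eq_integral) auto
  have pt: "ennreal ((convolve k f z - (\<integral>w. k w \<partial>lborel) * f z)\<^sup>2)
      \<le> ennreal K * (\<integral>\<^sup>+w. ennreal \<bar>k w\<bar> * ennreal ((f (z - w) - f z)\<^sup>2) \<partial>lborel)" for z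
  proof -
    have int: "integrable lborel (\<lambda>w. k w * f (z - w))" "integrable lborel (\<lambda>w. k w * f z)"
      using convolve_eq_shift(1)[OF k f] compact_cont_integrable[OF k] by auto
    have "convolve k f z - (\<integral>w. k w \<partial>lborel) * f z = (\<integral>w. k w * f (z - w) \<partial>lborel) - (\<integral>w. k w * f z \<partial>lborel)"
      using convolve_eq_shift(2)[OF k f] by simp
    also have "\<dots> = (\<integral>w. k w * (f (z - w) - f z) \<partial>lborel)"
      by (subst Bochner_Integration.integral_diff[OF int, symmetric]) (simp add: right_diff_distrib)
    finally have "ennreal \<bar>convolve k f z - (\<integral>w. k w \<partial>lborel) * f z\<bar>
        \<le> (\<integral>\<^sup>+w. ennreal (norm (k w * (f (z - w) - f z))) \<partial>lborel)"
      using integral_norm_bound_ennreal[of lborel "\<lambda>w. k w * (f (z - w) - f z)"] int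
      by (simp add: right_diff_distrib)
    also have "\<dots> = (\<integral>\<^sup>+w. ennreal (sqrt \<bar>k w\<bar>) * ennreal (sqrt \<bar>k w\<bar> * \<bar>f (z - w) - f z\<bar>) \<partial>lborel)"
      by (simp add: abs_mult flip: ennreal_mult mult.assoc)
    finally have "(ennreal \<bar>convolve k f z - (\<integral>w. k w \<partial>lborel) * f z\<bar>)\<^sup>2
        \<le> (\<integral>\<^sup>+w. ennreal (sqrt \<bar>k w\<bar>) * ennreal (sqrt \<bar>k w\<bar> * \<bar>f (z - w) - f z\<bar>) \<partial>lborel)\<^sup>2"
      by (rule power_mono) simp
    also have "\<dots> \<le> (\<integral>\<^sup>+w. (ennreal (sqrt \<bar>k w\<bar>))\<^sup>2 \<partial>lborel)
        * (\<integral>\<^sup>+w. (ennreal (sqrt \<bar>k w\<bar> * \<bar>f (z - w) - f z\<bar>))\<^sup>2 \<partial>lborel)"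
      by (intro Cauchy_Schwarz_nn_integral) measurable
    also have "\<dots> = ennreal K * (\<integral>\<^sup>+w. ennreal \<bar>k w\<bar> * ennreal ((f (z - w) - f z)\<^sup>2) \<partial>lborel)"
      by (simp add: ennreal_power power_mult_distrib nK ennreal_mult)
    finally show ?thesis by (simp add: ennreal_power)
  qed
  have "(\<integral>\<^sup>+z. ennreal ((convolve k f z - (\<integral>w. k w \<partial>lborel) * f z)\<^sup>2) \<partial>lborel)
      \<le> (\<integral>\<^sup>+z. ennreal K * (\<integral>\<^sup>+w. ennreal \<bar>k w\<bar> * ennreal ((f (z - w) - f z)\<^sup>2) \<partial>lborel) \<partial>lborel)"
    by (intro nn_integral_mono pt)
  also have "\<dots> = ennreal K * (\<integral>\<^sup>+z. (\<integral>\<^sup>+w. ennreal \<bar>k w\<bar> * ennreal ((f (z - w) - f z)\<^sup>2) \<partial>lborel) \<partial>lborel)"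
    by (intro nn_integral_cmult) measurable
  also have "(\<integral>\<^sup>+z. (\<integral>\<^sup>+w. ennreal \<bar>k w\<bar> * ennreal ((f (z - w) - f z)\<^sup>2) \<partial>lborel) \<partial>lborel)
      = (\<integral>\<^sup>+w. (\<integral>\<^sup>+z. ennreal \<bar>k w\<bar> * ennreal ((f (z - w) - f z)\<^sup>2) \<partial>lborel) \<partial>lborel)"
    by (intro lborel_pair.Fubini') measurable
  also have "\<dots> = (\<integral>\<^sup>+w. ennreal \<bar>k w\<bar> * (\<integral>\<^sup>+z. ennreal ((f (z - w) - f z)\<^sup>2) \<partial>lborel) \<partial>lborel)"
    by (intro nn_integral_cong nn_integral_cmult) measurable
  also have "\<dots> \<le> (\<integral>\<^sup>+w. ennreal \<bar>k w\<bar> * ennreal E \<partial>lborel)"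
  proof (rule nn_integral_mono)
    fix w
    show "ennreal \<bar>k w\<bar> * (\<integral>\<^sup>+z. ennreal ((f (z - w) - f z)\<^sup>2) \<partial>lborel) \<le> ennreal \<bar>k w\<bar> * ennreal E"
    proof (cases "k w = 0")
      case False
      have "L2fun (\<lambda>z. f (z - w) - f z)" using L2fun_diff[OF L2fun_shift[OF f, of "-w"] f] by simp
      then have "(\<integral>\<^sup>+z. ennreal ((f (z - w) - f z)\<^sup>2) \<partial>lborel) = ennreal (\<integral>z. (f (z - w) - f z)\<^sup>2 \<partial>lborel)"
        by (intro nn_integral_eq_integral L2fun_integrable) auto
      also have "\<dots> \<le> ennreal E" using E[OF False] by (rule ennreal_leI)
      finally show ?thesis by (rule mult_left_mono) simp
    qed simp
  qed
  also have "\<dots> = ennreal K * ennreal E"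
    by (subst nn_integral_multc) (auto simp: nK)
  finally have "(\<integral>\<^sup>+z. ennreal ((convolve k f z - (\<integral>w. k w \<partial>lborel) * f z)\<^sup>2) \<partial>lborel)
    \<le> ennreal K * (ennreal K * ennreal E)" by (simp add: mult_left_mono)
  also have "\<dots> = ennreal (K\<^sup>2 * E)"
    using K0 by (simp add: power2_eq_square ennreal_mult' mult.assoc)
  finally show ?thesis by (simp add: K_def)
qed

text \<open>By translation invariance the crude bound of four times the squared norm of
  \<open>f\<close> serves as \<open>E\<close> for every shift, which already gives
  finiteness.\<close>

lemma convolve_L2fun_diff:
  fixes f :: "'a::euclidean_space \<Rightarrow> real"
  assumes k: "compact_cont k" and f: "L2fun f"
  shows "L2fun (\<lambda>z. convolve k f z - (\<integral>w. k w \<partial>lborel) * f z)"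
proof -
  have m [measurable]: "convolve k f \<in> borel_measurable borel"
    using convolve_continuous[OF k f] by (rule borel_measurable_continuous_onI)
  note [measurable] = L2fun_measurable[OF f]
  define N where "N = (\<integral>z. (f z)\<^sup>2 \<partial>lborel)"
  have E: "(\<integral>z. (f (z - w) - f z)\<^sup>2 \<partial>lborel) \<le> 4 * N" for w
  proof -
    have i: "integrable lborel (\<lambda>z. (f (z - w))\<^sup>2)" "integrable lborel (\<lambda>z. (f z)\<^sup>2)"
      using L2fun_integrable[OF L2fun_shift[OF f, of "-w"]] L2fun_integrable[OF f] by auto
    have "(\<integral>z. (f (z - w) - f z)\<^sup>2 \<partial>lborel) \<le> (\<integral>z. 2 * (f (z - w))\<^sup>2 + 2 * (f z)\<^sup>2 \<partial>lborel)"
    proof (rule integral_mono')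
      show "(f (z - w) - f z)\<^sup>2 \<le> 2 * (f (z - w))\<^sup>2 + 2 * (f z)\<^sup>2" for z
        using zero_le_power2[of "f (z - w) + f z"] by (simp add: power2_eq_square algebra_simps)
    qed (use i in auto)
    also have "\<dots> = 2 * (\<integral>z. (f (z - w))\<^sup>2 \<partial>lborel) + 2 * N"
      using i by (simp add: N_def)
    also have "(\<integral>z. (f (z - w))\<^sup>2 \<partial>lborel) = N"
      using integral_lborel_plus[of "\<lambda>z. (f z)\<^sup>2" "-w"] by (simp add: N_def)
    finally show ?thesis by simp
  qed
  have "integrable lborel (\<lambda>z. (convolve k f z - (\<integral>w. k w \<partial>lborel) * f z)\<^sup>2)"
    by (rule integrableI_nonneg)
      (use order.strict_trans1[OF convolve_L2_bound[OF k f E]] in auto)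
  then show ?thesis by (simp add: L2fun_def)
qed

lemma convolve_L2fun: "compact_cont k \<Longrightarrow> L2fun f \<Longrightarrow> L2fun (convolve k f)"
  using L2fun_add[OF convolve_L2fun_diff L2fun_cmult, of k f f "\<integral>w. k w \<partial>lborel"] by simp

text \<open>The dilation that preserves the integral; as \<open>c\<close> grows, the kernel
  concentrates at 0. It is used with c = n + 1, which is never 0.\<close>

definition rescale :: "real \<Rightarrow> ('a::euclidean_space \<Rightarrow> real) \<Rightarrow> 'a \<Rightarrow> real" where
  "rescale c k z = c ^ DIM('a) * k (c *\<^sub>R z)"

lemma rescale_compact_cont: "compact_cont k \<Longrightarrow> c > 0 \<Longrightarrow> compact_cont (rescale c k)"
  using compact_cont_mult_left[OF compact_cont_affine[of k c 0], of "\<lambda>_. c ^ DIM('a)"] by (simp add: rescale_def[abs_def])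

lemma integral_rescale:
  assumes "k \<in> borel_measurable borel" "c > 0"
  shows "(\<integral>z. rescale c k z \<partial>lborel) = (\<integral>z. k z \<partial>lborel)"
  using integral_lborel_affine[OF assms(1), of c 0] assms(2) by (simp add: rescale_def)

text \<open>Kernels of arbitrary integral are allowed on purpose: integral 1 gives an approximation
  of the identity, integral 0 makes the commutator disappear. The integral of |k| does not depend on
  the scale, while the support shrinks to radius r / (n + 1), where translations move
  \<open>f\<close> little.\<close>

lemma convolve_rescale_L2lim:
  fixes f :: "'a::euclidean_space \<Rightarrow> real"
  assumes k: "compact_cont k" and f: "L2fun f"
  shows "L2lim (\<lambda>n. convolve (rescale (real (Suc n)) k) f) (\<lambda>z. (\<integral>w. k w \<partial>lborel) * f z)"
  unfolding L2lim_def
proof (intro conjI allI)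
  note [measurable] = compact_cont_measurable[OF k]
  have sk: "compact_cont (rescale (real (Suc n)) k)" for n by (rule rescale_compact_cont[OF k]) simp
  show "L2fun (convolve (rescale (real (Suc n)) k) f)" for n by (rule convolve_L2fun[OF sk f])
  show "L2fun (\<lambda>z. (\<integral>w. k w \<partial>lborel) * f z)" by (rule L2fun_cmult[OF f])
  have I: "(\<integral>w. rescale (real (Suc n)) k w \<partial>lborel) = (\<integral>w. k w \<partial>lborel)" for n
    by (rule integral_rescale) auto
  have Ia: "(\<integral>w. \<bar>rescale (real (Suc n)) k w\<bar> \<partial>lborel) = (\<integral>w. \<bar>k w\<bar> \<partial>lborel)" for n
    using integral_rescale[of "\<lambda>w. \<bar>k w\<bar>" "real (Suc n)"] by (simp add: rescale_def abs_mult)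
  define K where "K = (\<integral>w. \<bar>k w\<bar> \<partial>lborel)"
  obtain r B where r: "0 < r" "\<And>z. norm z > r \<Longrightarrow> k z = 0" "0 < B" "\<And>z. \<bar>k z\<bar> \<le> B"
    by (rule compact_contE[OF k], rule that)
  show "(\<lambda>n. \<integral>x. (convolve (rescale (real (Suc n)) k) f x - (\<integral>w. k w \<partial>lborel) * f x)\<^sup>2 \<partial>lborel) \<longlonglongrightarrow> 0"
  proof (rule LIMSEQ_I)
    fix e :: real assume e: "e > 0"
    \<comment> \<open>The 1 keeps the denominator positive for K = 0; the 2 turns the bound by e / 2
      into a strict one.\<close>
    define e' where "e' = e / (2 * (K\<^sup>2 + 1))"
    have K1: "K\<^sup>2 + 1 > 0" by (simp add: add_nonneg_pos)
    have e': "e' > 0" using e K1 by (simp add: e'_def)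
    have Ke: "K\<^sup>2 * e' < e"
    proof -
      have "K\<^sup>2 * e' \<le> (K\<^sup>2 + 1) * e'" using e' by simp
      also have "\<dots> = e / 2" using K1 by (simp add: e'_def field_simps)
      finally show ?thesis using e by simp
    qed
    obtain d where d: "d > 0" "\<And>h. norm h < d \<Longrightarrow> (\<integral>z. (f (z + h) - f z)\<^sup>2 \<partial>lborel) \<le> e'"
      using L2fun_shift_continuous[OF f e'] by blast
    obtain n0 :: nat where n0: "r / d < real n0" using reals_Archimedean2 by blast
    show "\<exists>no. \<forall>n\<ge>no. norm ((\<integral>x. (convolve (rescale (real (Suc n)) k) f x - (\<integral>w. k w \<partial>lborel) * f x)\<^sup>2 \<partial>lborel) - 0) < e"
    proof (intro exI[of _ n0] allI impI)
      fix n assume n: "n \<ge> n0"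
      define g where "g x = convolve (rescale (real (Suc n)) k) f x - (\<integral>w. k w \<partial>lborel) * f x" for x
      have "L2fun g" unfolding g_def using convolve_L2fun_diff[OF sk f, of n] unfolding I .
      have "(\<integral>\<^sup>+z. ennreal ((g z)\<^sup>2) \<partial>lborel) \<le> ennreal (K\<^sup>2 * e')"
        unfolding g_def K_def
      proof (rule convolve_L2_bound[OF sk f, of n e', unfolded I Ia])
        fix w assume "rescale (real (Suc n)) k w \<noteq> 0"
        then have "norm (real (Suc n) *\<^sub>R w) \<le> r"
          using r(2)[of "real (Suc n) *\<^sub>R w"] by (auto simp: rescale_def not_less[symmetric])
        then have "real (Suc n) * norm w \<le> r" by simp
        also have "r < real n0 * d" using n0 d(1) by (simp add: field_simps)
        also have "\<dots> \<le> real (Suc n) * d" using n d(1) by simp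
        finally have "norm (- w) < d" by (simp del: of_nat_Suc)
        from d(2)[OF this] show "(\<integral>z. (f (z - w) - f z)\<^sup>2 \<partial>lborel) \<le> e'" by simp
      qed
      also have "(\<integral>\<^sup>+z. ennreal ((g z)\<^sup>2) \<partial>lborel) = ennreal (\<integral>z. (g z)\<^sup>2 \<partial>lborel)"
        using L2fun_integrable[OF \<open>L2fun g\<close>] by (intro nn_integral_eq_integral) auto
      finally have "(\<integral>z. (g z)\<^sup>2 \<partial>lborel) \<le> K\<^sup>2 * e'"
        using e' by (subst (asm) ennreal_le_iff) auto
      then show "norm ((\<integral>x. (convolve (rescale (real (Suc n)) k) f x - (\<integral>w. k w \<partial>lborel) * f x)\<^sup>2 \<partial>lborel) - 0) < e"
        using Ke unfolding g_def[symmetric] by simp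
    qed
  qed
qed

text \<open>The product of flat functions of 1 - z_b and 1 + z_b is positive exactly on the open
  cube |z_b| < 1. A nonempty open set is not negligible, so the integral is nonzero and can be
  normalised. The radius \<open>DIM('a)\<close> comes from bounding the norm by the sum of the
  coordinates.\<close>

lemma smooth_bump_exists:
  obtains \<beta> :: "'a::euclidean_space \<Rightarrow> real"
  where "smooth_fun \<beta>" "compact_cont \<beta>" "(\<integral>z. \<beta> z \<partial>lborel) = 1"
proof -
  define g where "g = flat_exp 1"
  have g: "smooth_fun g" "g t \<ge> 0" "t \<le> 0 \<Longrightarrow> g t = 0" "g 1 > 0" for t
    by (auto simp: g_def smooth_fun_flat_exp) (auto simp: flat_exp_def)
  define \<beta> where "\<beta> z = (\<Prod>b\<in>Basis. g (- (z \<bullet> b) + 1) * g (z \<bullet> b + 1))" for z :: 'a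
  have s: "smooth_fun \<beta>"
    unfolding \<beta>_def
    by (intro smooth_fun_prod smooth_fun_mult smooth_fun_affine[OF g(1)] bounded_linear_minus
        bounded_linear_inner_left finite_Basis)
  have "\<beta> z = 0" if "norm z > real DIM('a)" for z
  proof (rule ccontr)
    assume "\<beta> z \<noteq> 0"
    then have "\<bar>z \<bullet> b\<bar> \<le> 1" if "b \<in> Basis" for b
      using that g(3)[of "- (z \<bullet> b) + 1"] g(3)[of "z \<bullet> b + 1"] by (force simp: \<beta>_def)
    then have "(\<Sum>b\<in>Basis. \<bar>z \<bullet> b\<bar>) \<le> (\<Sum>b\<in>(Basis::'a set). 1)" by (intro sum_mono) auto
    then show False using that norm_le_l1[of z] by simp
  qed
  then have c: "compact_cont \<beta>" unfolding compact_cont_def using smooth_fun_continuous[OF s] by blast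
  have nn: "\<beta> z \<ge> 0" for z unfolding \<beta>_def using g(2) by (intro prod_nonneg) auto
  have "(\<integral>z. \<beta> z \<partial>lborel) \<noteq> 0"
  proof
    assume "(\<integral>z. \<beta> z \<partial>lborel) = 0"
    then have "AE z in lborel. \<beta> z = 0"
      using integral_nonneg_eq_0_iff_AE[OF compact_cont_integrable[OF c]] nn by simp
    then have "{z. \<beta> z \<noteq> 0} \<in> null_sets lborel"
      using compact_cont_measurable[OF c] by (subst (asm) AE_iff_null) auto
    then have "negligible {z. \<beta> z \<noteq> 0}"
      using null_sets_completionI negligible_iff_null_sets by blast
    moreover have "open {z. \<beta> z \<noteq> 0}"
      using smooth_fun_continuous[OF s] by (intro open_Collect_neq continuous_on_const)
    moreover have "0 \<in> {z. \<beta> z \<noteq> 0}" using g(4) by (simp add: \<beta>_def)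
    ultimately show False using open_not_negligible by blast
  qed
  then show ?thesis
    by (intro that[of "\<lambda>z. inverse (\<integral>z. \<beta> z \<partial>lborel) * \<beta> z"] smooth_fun_mult[OF smooth_fun_const s]
        compact_cont_mult_left[OF c]) auto
qed

subsection \<open>The energy identity\<close>

lemma smooth_fun_dir_deriv: "smooth_fun f \<Longrightarrow> dir_deriv v f (\<lambda>p. frechet_derivative f (at p) v)"
  unfolding dir_deriv_def
proof (intro conjI allI)
  assume s: "smooth_fun f"
  show "continuous_on UNIV f" "continuous_on UNIV (\<lambda>p. frechet_derivative f (at p) v)"
    by (rule smooth_fun_continuous[OF s], rule smooth_fun_continuous[OF smooth_fun_frechet[OF s]])
  fix z
  have f: "(f has_derivative frechet_derivative f (at z)) (at (z + 0 *\<^sub>R v))"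
    using smooth_fun_has_derivative[OF s] by simp
  have "((\<lambda>t. z + t *\<^sub>R v) has_derivative (\<lambda>t. t *\<^sub>R v)) (at 0)"
    by (auto intro!: derivative_eq_intros)
  from has_derivative_compose[OF this f]
  show "((\<lambda>t. f (z + t *\<^sub>R v)) has_real_derivative frechet_derivative f (at z) v) (at 0)"
    using linear_cmul[OF has_derivative_linear[OF smooth_fun_has_derivative[OF s, of z]]]
    by (simp add: has_field_derivative_def mult.commute[of _ "frechet_derivative f (at z) v"])
qed

text \<open>The derivative of the product A B \<psi> has integral 0. Compact support is asked of the
  weight alone, since \<open>A\<close> and \<open>B\<close> will be mollified functions that are not
  cut off themselves.\<close>

lemma integral_by_parts_dir_deriv:
  assumes A: "dir_deriv v A A'" and B: "dir_deriv v B B'" and P: "dir_deriv v \<psi> \<psi>'" and c: "compact_cont \<psi>"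
  shows "(\<integral>z. A' z * B z * \<psi> z \<partial>lborel) =
    - (\<integral>z. A z * B' z * \<psi> z \<partial>lborel) - (\<integral>z. A z * B z * \<psi>' z \<partial>lborel)"
proof -
  have co: "continuous_on UNIV A" "continuous_on UNIV A'" "continuous_on UNIV B" "continuous_on UNIV B'"
    using A B by (auto simp: dir_deriv_def)
  have c': "compact_cont \<psi>'" by (rule dir_deriv_compact_cont[OF P c])
  have i: "integrable lborel (\<lambda>z. A' z * B z * \<psi> z)" "integrable lborel (\<lambda>z. A z * B' z * \<psi> z)"
    "integrable lborel (\<lambda>z. A z * B z * \<psi>' z)"
    by (intro compact_cont_integrable compact_cont_mult_left c c' continuous_on_mult co)+
  have "(\<integral>z. (A' z * B z + A z * B' z) * \<psi> z + A z * B z * \<psi>' z \<partial>lborel) = 0"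
    by (rule integral_dir_deriv_zero[OF dir_deriv_mult[OF dir_deriv_mult[OF A B] P]])
      (intro compact_cont_mult_left c continuous_on_mult co)
  also have "(\<lambda>z. (A' z * B z + A z * B' z) * \<psi> z + A z * B z * \<psi>' z)
      = (\<lambda>z. A' z * B z * \<psi> z + A z * B' z * \<psi> z + A z * B z * \<psi>' z)"
    by (simp add: algebra_simps)
  finally show ?thesis using i by simp
qed

lemma smooth_fun_rescale: "smooth_fun k \<Longrightarrow> smooth_fun (rescale c k)"
  using smooth_fun_mult[OF smooth_fun_const smooth_fun_affine[of k "\<lambda>p. c *\<^sub>R p" 0]]
  by (simp add: rescale_def[abs_def] bounded_linear_scaleR_right)

lemma frechet_derivative_rescale:
  fixes k :: "'a::euclidean_space \<Rightarrow> real"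
  assumes "smooth_fun k"
  shows "frechet_derivative (rescale c k) (at p) v = c ^ DIM('a) * (c * frechet_derivative k (at (c *\<^sub>R p)) v)"
proof -
  have "((\<lambda>p. k (c *\<^sub>R p)) has_derivative (\<lambda>v. frechet_derivative k (at (c *\<^sub>R p)) (c *\<^sub>R v))) (at p)"
    by (rule has_derivative_compose[OF _ smooth_fun_has_derivative[OF assms]])
      (auto intro!: derivative_eq_intros)
  then have "(rescale c k has_derivative (\<lambda>v. c ^ DIM('a) * frechet_derivative k (at (c *\<^sub>R p)) (c *\<^sub>R v))) (at p)"
    unfolding rescale_def[abs_def] by (rule has_derivative_mult_right)
  then have "frechet_derivative (rescale c k) (at p) v = c ^ DIM('a) * frechet_derivative k (at (c *\<^sub>R p)) (c *\<^sub>R v)"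
    by (simp add: frechet_derivative_eq)
  then show ?thesis
    using linear_cmul[OF has_derivative_linear[OF smooth_fun_has_derivative[OF assms, of "c *\<^sub>R p"]]]
    by simp
qed

lemma frechet_derivative_reflect:
  assumes "smooth_fun k"
  shows "frechet_derivative (\<lambda>p. k (z - p)) (at p) v = - frechet_derivative k (at (z - p)) v"
proof -
  have "((\<lambda>p. k (z - p)) has_derivative (\<lambda>v. frechet_derivative k (at (z - p)) (- v))) (at p)"
    by (rule has_derivative_compose[OF _ smooth_fun_has_derivative[OF assms]])
      (auto intro!: derivative_eq_intros)
  then show ?thesis
    using linear_neg[OF has_derivative_linear[OF smooth_fun_has_derivative[OF assms, of "z - p"]]]
    by (simp add: frechet_derivative_eq)
qed

lemma smooth_fun_reflect: "smooth_fun k \<Longrightarrow> smooth_fun (\<lambda>p. k (z - p))"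
  using smooth_fun_affine[of k uminus z] by (simp add: bounded_linear_minus bounded_linear_ident)

text \<open>Time is constrained from above only: the equation of the function extended by 0 may be
  tested with functions whose support reaches into t \<le> 0.\<close>

lemma test_fun_reflect:
  fixes z :: "('n::finite,'m::finite) pt"
  assumes "smooth_fun k" "\<And>z. norm z > r \<Longrightarrow> k z = 0" "snd z + r < T"
  shows "test_fun {p. snd p < T} (\<lambda>p. k (z - p))"
  unfolding test_fun_def
proof (intro conjI exI[of _ "cball z r"])
  show "cball z r \<subseteq> {p. snd p < T}"
  proof
    fix p assume "p \<in> cball z r"
    then have "norm (snd (z - p)) \<le> r"
      using dist_snd_le[of z p] by (simp add: dist_norm)
    then show "p \<in> {p. snd p < T}" using assms(3) by auto
  qed
qed (use assms smooth_fun_reflect in \<open>auto simp: dist_norm not_le\<close>)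

lemma L2lim_unique_mult:
  assumes "L2lim F f" "L2lim G g" "compact_cont b"
  shows "(\<lambda>n. \<integral>x. F n x * G n x * b x \<partial>lborel) \<longlonglongrightarrow> (\<integral>x. f x * g x * b x \<partial>lborel)"
proof -
  obtain B where B: "\<And>z. \<bar>b z\<bar> \<le> B" by (rule compact_contE[OF assms(3)], rule that)
  show ?thesis by (rule L2lim_mult[OF assms(1,2) compact_cont_measurable[OF assms(3)] B])
qed

lemma dir_deriv_const_fst:
  "dir_deriv ((0, w), s) (\<lambda>p::('n::finite,'m::finite) pt. fst (fst p) $ i) (\<lambda>_. 0)"
  unfolding dir_deriv_def by (auto intro!: continuous_intros)

lemma continuous_on_fst_nth:
  "continuous_on S (\<lambda>p::('n::finite,'m::finite) pt. fst (fst p) $ i)"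
  by (intro continuous_intros)

text \<open>Formally this is the equation tested with u \<psi>, for an abstract flux
  \<open>F\<close>, weak gradient \<open>G\<close> and right-hand side \<open>f\<close>. The weight
  \<psi> is never itself a test function, only a factor after regularisation, hence C1 is enough for
  it. The gap between \<open>T'\<close> and \<open>T\<close> is the room that the mollifier
  needs.\<close>

lemma energy_identity:
  fixes u f \<psi> \<psi>t :: "('n::finite,'m::finite) pt \<Rightarrow> real" and F G \<psi>x :: "'n \<Rightarrow> ('n,'m) pt \<Rightarrow> real"
    and \<psi>y :: "'m \<Rightarrow> ('n,'m) pt \<Rightarrow> real" and \<iota> :: "'m \<Rightarrow> 'n"
  assumes L2: "L2fun u" "L2fun f" "\<And>i. L2fun (F i)" "\<And>i. L2fun (G i)"
    and grad: "\<And>i \<phi>. test_fun {p. snd p < T} \<phi> \<Longrightarrow>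
      (\<integral>p. u p * dx i \<phi> p \<partial>lborel) = - (\<integral>p. G i p * \<phi> p \<partial>lborel)"
    and eq: "\<And>\<phi>. test_fun {p. snd p < T} \<phi> \<Longrightarrow>
      (\<integral>p. - (\<Sum>i\<in>UNIV. F i p * dx i \<phi> p)
        + u p * (- (\<Sum>l\<in>UNIV. fst (fst p) $ \<iota> l * dy l \<phi> p) + dt \<phi> p) \<partial>lborel)
      = (\<integral>p. f p * \<phi> p \<partial>lborel)"
    and \<psi>: "compact_cont \<psi>" "T' < T" "\<And>p. snd p \<ge> T' \<Longrightarrow> \<psi> p = 0"
    and \<psi>d: "\<And>i. dir_deriv ((axis i 1, 0), 0) \<psi> (\<psi>x i)" "\<And>l. dir_deriv ((0, axis l 1), 0) \<psi> (\<psi>y l)"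
      "dir_deriv ((0, 0), 1) \<psi> \<psi>t"
  shows "(\<integral>p. u p * u p * \<psi>t p \<partial>lborel) - (\<Sum>l\<in>UNIV. \<integral>p. u p * u p * (fst (fst p) $ \<iota> l * \<psi>y l p) \<partial>lborel)
    = 2 * ((\<Sum>i\<in>UNIV. \<integral>p. F i p * G i p * \<psi> p \<partial>lborel)
      + (\<Sum>i\<in>UNIV. \<integral>p. F i p * u p * \<psi>x i p \<partial>lborel) + (\<integral>p. f p * u p * \<psi> p \<partial>lborel))"
proof -
  obtain \<beta> :: "('n,'m) pt \<Rightarrow> real" where \<beta>: "smooth_fun \<beta>" "compact_cont \<beta>" "(\<integral>z. \<beta> z \<partial>lborel) = 1"
    by (rule smooth_bump_exists)
  obtain r where r: "r > 0" "\<And>z. norm z > r \<Longrightarrow> \<beta> z = 0" by (rule compact_contE[OF \<beta>(2)], rule that)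
  define \<rho> where "\<rho> n = rescale (real (Suc n)) \<beta>" for n
  define \<rho>d where "\<rho>d n v = (\<lambda>p. frechet_derivative (\<rho> n) (at p) v)" for n v
  \<comment> \<open>The commutator kernel at scale 1, coming from the part x_l(z - p) of x_l(p) =
    x_l(z) - x_l(z - p).\<close>
  define \<kappa> where "\<kappa> l = (\<lambda>p. fst (fst p) $ \<iota> l * frechet_derivative \<beta> (at p) ((0, axis l 1), 0))" for l
  define ex where "ex i = ((axis i 1 :: real^'n, 0 :: real^'m), 0 :: real)" for i
  define ey where "ey l = ((0 :: real^'n, axis l 1 :: real^'m), 0 :: real)" for l
  define et where "et = ((0 :: real^'n, 0 :: real^'m), 1 :: real)"
  have \<rho>s: "smooth_fun (\<rho> n)" for n unfolding \<rho>_def by (rule smooth_fun_rescale[OF \<beta>(1)])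
  have \<rho>c: "compact_cont (\<rho> n)" for n unfolding \<rho>_def by (rule rescale_compact_cont[OF \<beta>(2)]) simp
  have \<rho>d: "dir_deriv v (\<rho> n) (\<rho>d n v)" for n v unfolding \<rho>d_def by (rule smooth_fun_dir_deriv[OF \<rho>s])
  have \<rho>dc: "compact_cont (\<rho>d n v)" for n v by (rule dir_deriv_compact_cont[OF \<rho>d \<rho>c])
  have \<beta>d: "dir_deriv v \<beta> (\<lambda>p. frechet_derivative \<beta> (at p) v)" for v by (rule smooth_fun_dir_deriv[OF \<beta>(1)])
  have \<kappa>c: "compact_cont (\<kappa> l)" for l
    unfolding \<kappa>_def by (intro compact_cont_mult_left dir_deriv_compact_cont[OF \<beta>d \<beta>(2)] continuous_on_fst_nth)
  \<comment> \<open>As x_l is constant along y, the kernel is the y_l-derivative of x_l \<beta>,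
    which has compact support.\<close>
  have \<kappa>0: "(\<integral>z. \<kappa> l z \<partial>lborel) = 0" for l
    using integral_dir_deriv_zero[OF dir_deriv_mult[OF dir_deriv_const_fst \<beta>d] compact_cont_mult_left[OF \<beta>(2) continuous_on_fst_nth]]
    by (simp add: \<kappa>_def)
  \<comment> \<open>Differentiating the rescaled bump produces one factor n + 1, exactly the factor
    by which x_l is dilated. So the commutator kernel is again a dilation of a fixed kernel that
    preserves the integral.\<close>
  have \<kappa>rescale: "rescale (real (Suc n)) (\<kappa> l) z = fst (fst z) $ \<iota> l * \<rho>d n (ey l) z" for n l z
    unfolding \<rho>d_def \<rho>_def frechet_derivative_rescale[OF \<beta>(1)]
    by (simp add: rescale_def \<kappa>_def ey_def)
  have \<kappa>scc: "compact_cont (rescale (real (Suc n)) (\<kappa> l))" for n l by (rule rescale_compact_cont[OF \<kappa>c]) simp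
  have lim: "L2lim (\<lambda>n. convolve (\<rho> n) h) h" if "L2fun h" for h
    using convolve_rescale_L2lim[OF \<beta>(2) that] \<beta>(3) by (simp add: \<rho>_def)
  have lim0: "L2lim (\<lambda>n. convolve (rescale (real (Suc n)) (\<kappa> l)) h) (\<lambda>_. 0)" if "L2fun h" for h l
    using convolve_rescale_L2lim[OF \<kappa>c that, of l] \<kappa>0 by simp
  have test: "test_fun {p. snd p < T} (\<lambda>p. \<rho> n (z - p))" if "snd z + r / real (Suc n) < T" for n z
  proof (rule test_fun_reflect[OF \<rho>s _ that])
    fix w :: "('n,'m) pt" assume "r / real (Suc n) < norm w"
    then have "r < norm (real (Suc n) *\<^sub>R w)" by (simp add: field_simps del: of_nat_Suc)
    then show "\<rho> n w = 0" using r(2) by (simp add: \<rho>_def rescale_def)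
  qed
  have dphi: "frechet_derivative (\<lambda>p. \<rho> n (z - p)) (at p) v = - \<rho>d n v (z - p)" for n z p v
    unfolding \<rho>d_def by (rule frechet_derivative_reflect[OF \<rho>s])
  have grad': "convolve (\<rho>d n (ex i)) u z = convolve (\<rho> n) (G i) z" if "snd z + r / real (Suc n) < T" for n i z
    using grad[OF test[OF that], of i]
    by (simp add: dx_def dphi convolve_def ex_def[symmetric] mult.commute)
  have eq': "(\<Sum>i\<in>UNIV. convolve (\<rho>d n (ex i)) (F i) z) + (\<Sum>l\<in>UNIV. fst (fst z) $ \<iota> l * convolve (\<rho>d n (ey l)) u z)
      - (\<Sum>l\<in>UNIV. convolve (rescale (real (Suc n)) (\<kappa> l)) u z) - convolve (\<rho>d n et) u z = convolve (\<rho> n) f z"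
    if "snd z + r / real (Suc n) < T" for n z
  proof -
    have "convolve (\<rho> n) f z = (\<integral>p. - (\<Sum>i\<in>UNIV. F i p * - \<rho>d n (ex i) (z - p))
        + u p * (- (\<Sum>l\<in>UNIV. fst (fst p) $ \<iota> l * - \<rho>d n (ey l) (z - p)) + - \<rho>d n et (z - p)) \<partial>lborel)"
      using eq[OF test[OF that]]
      by (simp add: dx_def dy_def dt_def dphi convolve_def ex_def[symmetric] ey_def[symmetric] et_def[symmetric] mult.commute)
    also have "\<dots> = (\<integral>p. (\<Sum>i\<in>UNIV. \<rho>d n (ex i) (z - p) * F i p)
        + (\<Sum>l\<in>UNIV. fst (fst z) $ \<iota> l * (\<rho>d n (ey l) (z - p) * u p))
        - (\<Sum>l\<in>UNIV. rescale (real (Suc n)) (\<kappa> l) (z - p) * u p) - \<rho>d n et (z - p) * u p \<partial>lborel)"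
    proof (rule Bochner_Integration.integral_cong[OF refl])
      fix p
      \<comment> \<open>Here x_l(p) is split: x_l(z) leaves the integral and gives the transport of
        the regularised function, the rest is the commutator.\<close>
      have "(\<Sum>l\<in>UNIV. fst (fst z) $ \<iota> l * (\<rho>d n (ey l) (z - p) * u p))
        - (\<Sum>l\<in>UNIV. rescale (real (Suc n)) (\<kappa> l) (z - p) * u p)
        = u p * (\<Sum>l\<in>UNIV. fst (fst p) $ \<iota> l * \<rho>d n (ey l) (z - p))"
        unfolding \<kappa>rescale sum_subtractf[symmetric] sum_distrib_left
        by (rule sum.cong) (simp_all add: algebra_simps)
      then show "- (\<Sum>i\<in>UNIV. F i p * - \<rho>d n (ex i) (z - p))
        + u p * (- (\<Sum>l\<in>UNIV. fst (fst p) $ \<iota> l * - \<rho>d n (ey l) (z - p)) + - \<rho>d n et (z - p))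
        = (\<Sum>i\<in>UNIV. \<rho>d n (ex i) (z - p) * F i p)
        + (\<Sum>l\<in>UNIV. fst (fst z) $ \<iota> l * (\<rho>d n (ey l) (z - p) * u p))
        - (\<Sum>l\<in>UNIV. rescale (real (Suc n)) (\<kappa> l) (z - p) * u p) - \<rho>d n et (z - p) * u p"
        by (simp add: sum_negf algebra_simps)
    qed
    also have "\<dots> = (\<Sum>i\<in>UNIV. convolve (\<rho>d n (ex i)) (F i) z) + (\<Sum>l\<in>UNIV. fst (fst z) $ \<iota> l * convolve (\<rho>d n (ey l)) u z)
      - (\<Sum>l\<in>UNIV. convolve (rescale (real (Suc n)) (\<kappa> l)) u z) - convolve (\<rho>d n et) u z"
    proof -
      have i: "integrable lborel (\<lambda>p. \<rho>d n (ex i) (z - p) * F i p)"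
        "integrable lborel (\<lambda>p. \<rho>d n v (z - p) * u p)"
        "integrable lborel (\<lambda>p. rescale (real (Suc n)) (\<kappa> l) (z - p) * u p)" for i v l
        by (intro convolve_integrable \<rho>dc L2 \<kappa>scc)+
      show ?thesis
        unfolding convolve_def
        by (intro has_bochner_integral_integral_eq has_bochner_integral_add
            has_bochner_integral_diff has_bochner_integral_sum has_bochner_integral_mult_right
            has_bochner_integral_integrable i)
    qed
    finally show ?thesis by simp
  qed
  define w where "w n = convolve (\<rho> n) u" for n
  have cont: "continuous_on UNIV (convolve (\<rho> n) h)" "continuous_on UNIV (convolve (\<rho>d n v) h)"
     "continuous_on UNIV (convolve (rescale (real (Suc n)) (\<kappa> l)) h)" if "L2fun h" for n v h l
    by (intro convolve_continuous \<rho>c \<rho>dc \<kappa>scc that)+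
  have cvd: "dir_deriv v (convolve (\<rho> n) h) (convolve (\<rho>d n v) h)" if "L2fun h" for n v h
    by (rule convolve_dir_deriv[OF \<rho>c \<rho>d that])
  have \<psi>c: "compact_cont (\<psi>x i)" "compact_cont (\<psi>y l)" "compact_cont \<psi>t" for i l
    using dir_deriv_compact_cont[OF \<psi>d(1) \<psi>(1)] dir_deriv_compact_cont[OF \<psi>d(2) \<psi>(1)] dir_deriv_compact_cont[OF \<psi>d(3) \<psi>(1)] by auto
  have En: "(\<integral>p. w n p * w n p * \<psi>t p \<partial>lborel) - (\<Sum>l\<in>UNIV. \<integral>p. w n p * w n p * (fst (fst p) $ \<iota> l * \<psi>y l p) \<partial>lborel)
    = 2 * ((\<Sum>i\<in>UNIV. \<integral>p. convolve (\<rho> n) (F i) p * convolve (\<rho> n) (G i) p * \<psi> p \<partial>lborel)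
      + (\<Sum>i\<in>UNIV. \<integral>p. convolve (\<rho> n) (F i) p * w n p * \<psi>x i p \<partial>lborel) + (\<integral>p. convolve (\<rho> n) f p * w n p * \<psi> p \<partial>lborel)
      + (\<Sum>l\<in>UNIV. \<integral>p. convolve (rescale (real (Suc n)) (\<kappa> l)) u p * w n p * \<psi> p \<partial>lborel))"
    if n: "r / real (Suc n) < T - T'" for n
  proof -
    \<comment> \<open>On the set where \<psi> does not vanish the mollifier around z stays below
      time \<open>T\<close>, so the pointwise equations hold there; elsewhere the integrands are
      0.\<close>
    have on: "snd z + r / real (Suc n) < T" if "\<psi> z \<noteq> 0" for z
    proof -
      have "snd z < T'" using that \<psi>(3)[of z] by force
      then show ?thesis using n by linarith
    qed
    have "(\<integral>p. convolve (\<rho> n) f p * w n p * \<psi> p \<partial>lborel)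
      = (\<integral>p. (\<Sum>i\<in>UNIV. convolve (\<rho>d n (ex i)) (F i) p * w n p * \<psi> p)
        + (\<Sum>l\<in>UNIV. convolve (\<rho>d n (ey l)) u p * w n p * (fst (fst p) $ \<iota> l * \<psi> p))
        - (\<Sum>l\<in>UNIV. convolve (rescale (real (Suc n)) (\<kappa> l)) u p * w n p * \<psi> p) - convolve (\<rho>d n et) u p * w n p * \<psi> p \<partial>lborel)"
    proof (rule Bochner_Integration.integral_cong[OF refl])
      fix p
      show "convolve (\<rho> n) f p * w n p * \<psi> p = (\<Sum>i\<in>UNIV. convolve (\<rho>d n (ex i)) (F i) p * w n p * \<psi> p)
        + (\<Sum>l\<in>UNIV. convolve (\<rho>d n (ey l)) u p * w n p * (fst (fst p) $ \<iota> l * \<psi> p))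
        - (\<Sum>l\<in>UNIV. convolve (rescale (real (Suc n)) (\<kappa> l)) u p * w n p * \<psi> p) - convolve (\<rho>d n et) u p * w n p * \<psi> p"
      proof (cases "\<psi> p = 0")
        case False
        show ?thesis
          unfolding eq'[OF on[OF False], symmetric] left_diff_distrib distrib_right sum_distrib_right
          by (simp add: mult_ac)
      qed simp
    qed
    also have "\<dots> = (\<Sum>i\<in>UNIV. \<integral>p. convolve (\<rho>d n (ex i)) (F i) p * w n p * \<psi> p \<partial>lborel)
        + (\<Sum>l\<in>UNIV. \<integral>p. convolve (\<rho>d n (ey l)) u p * w n p * (fst (fst p) $ \<iota> l * \<psi> p) \<partial>lborel)
        - (\<Sum>l\<in>UNIV. \<integral>p. convolve (rescale (real (Suc n)) (\<kappa> l)) u p * w n p * \<psi> p \<partial>lborel)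
        - (\<integral>p. convolve (\<rho>d n et) u p * w n p * \<psi> p \<partial>lborel)"
    proof -
      have i: "integrable lborel (\<lambda>p. convolve (\<rho>d n (ex i)) (F i) p * w n p * \<psi> p)"
        "integrable lborel (\<lambda>p. convolve (\<rho>d n (ey l)) u p * w n p * (fst (fst p) $ \<iota> l * \<psi> p))"
        "integrable lborel (\<lambda>p. convolve (rescale (real (Suc n)) (\<kappa> l)) u p * w n p * \<psi> p)"
        "integrable lborel (\<lambda>p. convolve (\<rho>d n et) u p * w n p * \<psi> p)" for i l
        unfolding w_def
        by (intro compact_cont_integrable compact_cont_mult_left \<psi>(1) continuous_on_mult cont L2 continuous_on_fst_nth)+
      show ?thesis
        by (intro has_bochner_integral_integral_eq has_bochner_integral_add
            has_bochner_integral_diff has_bochner_integral_sum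
            has_bochner_integral_integrable i)
    qed
    finally have main: "(\<integral>p. convolve (\<rho> n) f p * w n p * \<psi> p \<partial>lborel)
      = (\<Sum>i\<in>UNIV. \<integral>p. convolve (\<rho>d n (ex i)) (F i) p * w n p * \<psi> p \<partial>lborel)
        + (\<Sum>l\<in>UNIV. \<integral>p. convolve (\<rho>d n (ey l)) u p * w n p * (fst (fst p) $ \<iota> l * \<psi> p) \<partial>lborel)
        - (\<Sum>l\<in>UNIV. \<integral>p. convolve (rescale (real (Suc n)) (\<kappa> l)) u p * w n p * \<psi> p \<partial>lborel)
        - (\<integral>p. convolve (\<rho>d n et) u p * w n p * \<psi> p \<partial>lborel)" .
    have I1: "(\<integral>p. convolve (\<rho>d n (ex i)) (F i) p * w n p * \<psi> p \<partial>lborel)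
        = - (\<integral>p. convolve (\<rho> n) (F i) p * convolve (\<rho> n) (G i) p * \<psi> p \<partial>lborel)
          - (\<integral>p. convolve (\<rho> n) (F i) p * w n p * \<psi>x i p \<partial>lborel)" for i
    proof -
      \<comment> \<open>The derivative of the regularised \<open>u\<close> is traded for the
        regularised weak gradient, which, unlike the derivative kernel, has a limit in L2.\<close>
      have "(\<integral>p. convolve (\<rho> n) (F i) p * convolve (\<rho>d n (ex i)) u p * \<psi> p \<partial>lborel)
          = (\<integral>p. convolve (\<rho> n) (F i) p * convolve (\<rho> n) (G i) p * \<psi> p \<partial>lborel)"
      proof (rule Bochner_Integration.integral_cong[OF refl])
        show "convolve (\<rho> n) (F i) p * convolve (\<rho>d n (ex i)) u p * \<psi> p
          = convolve (\<rho> n) (F i) p * convolve (\<rho> n) (G i) p * \<psi> p" for p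
          using grad'[OF on, of p i] by (cases "\<psi> p = 0") simp_all
      qed
      then show ?thesis
        using integral_by_parts_dir_deriv[OF cvd[OF L2(3)[of i], of "ex i" n] cvd[OF L2(1)] \<psi>d(1)[of i, folded ex_def] \<psi>(1)]
        by (simp add: w_def)
    qed
    have comm: "(\<lambda>p. w n p * convolve (\<rho>d n v) u p * P p) = (\<lambda>p. convolve (\<rho>d n v) u p * w n p * P p)" for v P
      by (intro ext arg_cong2[where f = times] mult.commute refl)
    \<comment> \<open>With both factors equal to \<open>w n\<close>, integration by parts returns
      the same integral with the opposite sign, hence one half. The factor x_l is counted as part of
      the weight, being constant along y_l.\<close>
    have I2: "(\<integral>p. convolve (\<rho>d n (ey l)) u p * w n p * (fst (fst p) $ \<iota> l * \<psi> p) \<partial>lborel)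
        = - (1/2) * (\<integral>p. w n p * w n p * (fst (fst p) $ \<iota> l * \<psi>y l p) \<partial>lborel)" for l
      using integral_by_parts_dir_deriv[OF cvd[OF L2(1), of "ey l" n] cvd[OF L2(1), of "ey l" n]
          dir_deriv_mult[OF dir_deriv_const_fst[where i = "\<iota> l"] \<psi>d(2)[of l], folded ey_def]
          compact_cont_mult_left[OF \<psi>(1) continuous_on_fst_nth], folded w_def]
      by (simp only: comm mult_zero_left add_0)
    have I3: "(\<integral>p. convolve (\<rho>d n et) u p * w n p * \<psi> p \<partial>lborel) = - (1/2) * (\<integral>p. w n p * w n p * \<psi>t p \<partial>lborel)"
      using integral_by_parts_dir_deriv[OF cvd[OF L2(1), of et n] cvd[OF L2(1), of et n] \<psi>d(3)[folded et_def] \<psi>(1), folded w_def]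
      unfolding comm by linarith
    \<comment> \<open>The letters are the time term \<open>A\<close>, the drift \<open>Y\<close>,
      the dissipation \<open>P\<close>, the flux against the cutoff gradient \<open>Q\<close>, the
      right-hand side \<open>R\<close> and the commutator \<open>K\<close>.\<close>
    have solve: "A - Y = 2 * (P + Q + R + K)" if "R = - P - Q + - (1/2) * Y - K - - (1/2) * A"
      for A Y P Q R K :: real
      using that by simp
    show ?thesis
      by (rule solve[OF main[unfolded I1 I2 I3 sum_subtractf sum_negf sum_distrib_left[symmetric]]])
  qed
  have L: "(\<lambda>n. (\<integral>p. w n p * w n p * \<psi>t p \<partial>lborel) - (\<Sum>l\<in>UNIV. \<integral>p. w n p * w n p * (fst (fst p) $ \<iota> l * \<psi>y l p) \<partial>lborel))
    \<longlonglongrightarrow> (\<integral>p. u p * u p * \<psi>t p \<partial>lborel) - (\<Sum>l\<in>UNIV. \<integral>p. u p * u p * (fst (fst p) $ \<iota> l * \<psi>y l p) \<partial>lborel)"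
    unfolding w_def
    by (intro tendsto_intros L2lim_unique_mult lim L2 \<psi>c compact_cont_mult_left continuous_on_fst_nth)
  \<comment> \<open>The last sum keeps an explicit factor 0: it is the L2 limit of the commutator,
    multiplied by a factor that merely converges.\<close>
  have R: "(\<lambda>n. 2 * ((\<Sum>i\<in>UNIV. \<integral>p. convolve (\<rho> n) (F i) p * convolve (\<rho> n) (G i) p * \<psi> p \<partial>lborel)
      + (\<Sum>i\<in>UNIV. \<integral>p. convolve (\<rho> n) (F i) p * w n p * \<psi>x i p \<partial>lborel) + (\<integral>p. convolve (\<rho> n) f p * w n p * \<psi> p \<partial>lborel)
      + (\<Sum>l\<in>UNIV. \<integral>p. convolve (rescale (real (Suc n)) (\<kappa> l)) u p * w n p * \<psi> p \<partial>lborel)))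
    \<longlonglongrightarrow> 2 * ((\<Sum>i\<in>UNIV. \<integral>p. F i p * G i p * \<psi> p \<partial>lborel)
      + (\<Sum>i\<in>UNIV. \<integral>p. F i p * u p * \<psi>x i p \<partial>lborel) + (\<integral>p. f p * u p * \<psi> p \<partial>lborel)
      + (\<Sum>l\<in>(UNIV::'m set). \<integral>p. 0 * u p * \<psi> p \<partial>lborel))"
    unfolding w_def
    by (intro tendsto_intros L2lim_unique_mult lim lim0 L2 \<psi>c \<psi>)
  have "(\<lambda>n. r * inverse (real (Suc n))) \<longlonglongrightarrow> r * 0"
    by (intro tendsto_intros LIMSEQ_inverse_real_of_nat)
  then have "\<forall>\<^sub>F n in sequentially. r / real (Suc n) < T - T'"
    using order_tendstoD(2)[of _ 0 sequentially "T - T'"] \<psi>(2) by (simp add: divide_inverse)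
  then have "\<forall>\<^sub>F n in sequentially. (\<integral>p. w n p * w n p * \<psi>t p \<partial>lborel) - (\<Sum>l\<in>UNIV. \<integral>p. w n p * w n p * (fst (fst p) $ \<iota> l * \<psi>y l p) \<partial>lborel)
    = 2 * ((\<Sum>i\<in>UNIV. \<integral>p. convolve (\<rho> n) (F i) p * convolve (\<rho> n) (G i) p * \<psi> p \<partial>lborel)
      + (\<Sum>i\<in>UNIV. \<integral>p. convolve (\<rho> n) (F i) p * w n p * \<psi>x i p \<partial>lborel) + (\<integral>p. convolve (\<rho> n) f p * w n p * \<psi> p \<partial>lborel)
      + (\<Sum>l\<in>UNIV. \<integral>p. convolve (rescale (real (Suc n)) (\<kappa> l)) u p * w n p * \<psi> p \<partial>lborel))"
    by (rule eventually_mono) (rule En)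
  from Lim_transform_eventually[OF L this] R show ?thesis
    using LIMSEQ_unique by fastforce
qed

subsection \<open>Cutoffs and uniqueness\<close>

lemma test_fun_smooth: "test_fun U \<phi> \<Longrightarrow> smooth_fun \<phi>"
  by (simp add: test_fun_def)

lemma test_fun_compact_cont:
  assumes "test_fun U \<phi>"
  shows "compact_cont \<phi>"
proof -
  obtain K where K: "compact K" "\<And>p. p \<notin> K \<Longrightarrow> \<phi> p = 0"
    using assms by (auto simp: test_fun_def)
  obtain r where "\<And>p. p \<in> K \<Longrightarrow> norm p \<le> r"
    using compact_imp_bounded[OF K(1)] by (auto simp: bounded_iff)
  then have "\<forall>p. norm p > r \<longrightarrow> \<phi> p = 0" using K(2) by (meson not_le)
  then show ?thesis
    using smooth_fun_continuous[OF test_fun_smooth[OF assms]] unfolding compact_cont_def by blast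
qed

text \<open>The factor \<open>exp (- 1 / (k t - 1))\<close>, extended by \<open>0\<close> to \<open>t \<le> 1 / k\<close>, commutes with the
  \<open>x\<close>-derivatives and tends to \<open>1\<close> for every \<open>t > 0\<close> as \<open>k\<close> tends to infinity.\<close>

lemma test_fun_times_initial_cutoff:
  fixes \<phi> :: "('n::finite,'m::finite) pt \<Rightarrow> real"
  assumes \<phi>: "test_fun {p. snd p < T} \<phi>" and k: "k > 0"
  shows "test_fun (Omega T) (\<lambda>p. \<phi> p * flat_exp 1 (k * snd p + - 1))"
    and "dx i (\<lambda>p. \<phi> p * flat_exp 1 (k * snd p + - 1)) p = dx i \<phi> p * flat_exp 1 (k * snd p + - 1)"
proof -
  define \<eta> where "\<eta> p = flat_exp 1 (k * snd p + - 1)" for p :: "('n,'m) pt"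
  have L: "bounded_linear (\<lambda>p::('n,'m) pt. k * snd p)"
    by (rule bounded_linear_const_mult[OF bounded_linear_snd])
  have \<eta>: "smooth_fun \<eta>"
    unfolding \<eta>_def by (rule smooth_fun_affine[OF smooth_fun_flat_exp L])
  have zero: "\<eta> p = 0" if "snd p < 1 / k" for p
    using that k by (simp add: \<eta>_def flat_exp_def field_simps)
  obtain K where K: "compact K" "K \<subseteq> {p. snd p < T}" "\<And>p. p \<notin> K \<Longrightarrow> \<phi> p = 0"
    using \<phi> by (auto simp: test_fun_def)
  have "closed {p::('n,'m) pt. snd p \<ge> 1 / k}"
    by (intro closed_Collect_le continuous_intros)
  then have "compact (K \<inter> {p. snd p \<ge> 1 / k})" by (rule compact_Int_closed[OF K(1)])
  moreover have "K \<inter> {p. snd p \<ge> 1 / k} \<subseteq> Omega T"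
  proof
    fix p assume p: "p \<in> K \<inter> {p. snd p \<ge> 1 / k}"
    have "0 < 1 / k" using k by simp
    also have "1 / k \<le> snd p" using p by simp
    finally show "p \<in> Omega T" using p K(2) by (auto simp: Omega_def)
  qed
  moreover have "\<phi> p * \<eta> p = 0" if "p \<notin> K \<inter> {p. snd p \<ge> 1 / k}" for p
    using that K(3) zero by (cases "p \<in> K") auto
  ultimately show "test_fun (Omega T) (\<lambda>p. \<phi> p * flat_exp 1 (k * snd p + - 1))"
    unfolding test_fun_def \<eta>_def[symmetric]
    by (intro conjI smooth_fun_mult[OF test_fun_smooth[OF \<phi>] \<eta>] exI[of _ "K \<inter> {p. snd p \<ge> 1 / k}"]) auto
  define g where "g = frechet_derivative (flat_exp 1) (at (k * snd p + - 1))"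
  have g: "(flat_exp 1 has_derivative g) (at (k * snd p + - 1))"
    unfolding g_def by (rule smooth_fun_has_derivative[OF smooth_fun_flat_exp])
  have "((\<lambda>p. k * snd p + - 1) has_derivative (\<lambda>v. k * snd v)) (at p)"
    by (auto intro!: derivative_eq_intros)
  from has_derivative_compose[OF this g]
  have "(\<eta> has_derivative (\<lambda>v. g (k * snd v))) (at p)" by (simp add: \<eta>_def[abs_def])
  from frechet_derivative_eq[OF has_derivative_mult[OF smooth_fun_has_derivative[OF test_fun_smooth[OF \<phi>]] this]]
  show "dx i (\<lambda>p. \<phi> p * flat_exp 1 (k * snd p + - 1)) p = dx i \<phi> p * flat_exp 1 (k * snd p + - 1)"
    using linear_0[OF has_derivative_linear[OF g]]
    unfolding dx_def \<eta>_def[symmetric] by simp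
qed

lemma flat_exp_1_bounds: "0 \<le> flat_exp 1 s" "flat_exp 1 s \<le> 1"
  by (auto simp: flat_exp_def)

lemma flat_exp_1_tendsto:
  assumes "t > 0"
  shows "(\<lambda>n. flat_exp 1 (real (Suc n) * t + - 1)) \<longlonglongrightarrow> 1"
proof -
  have lim: "filterlim (\<lambda>n. real (Suc n) * t + - 1) at_top sequentially"
    by (subst add.commute, rule filterlim_tendsto_add_at_top[OF tendsto_const],
      rule filterlim_at_top_mult_tendsto_pos[OF tendsto_const assms],
      rule filterlim_compose[OF filterlim_real_sequentially filterlim_Suc])
  have "((\<lambda>s. exp (- inverse s)) \<longlongrightarrow> exp (- 0 :: real)) at_top"
    by (intro tendsto_intros tendsto_inverse_0_at_top filterlim_ident)
  moreover have "\<forall>\<^sub>F s in at_top. exp (- inverse s) = flat_exp 1 s"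
    using eventually_gt_at_top[of 0] by eventually_elim (simp add: flat_exp_def divide_inverse)
  ultimately have "((\<lambda>s. flat_exp 1 s) \<longlongrightarrow> 1) at_top"
    using Lim_transform_eventually by fastforce
  then show ?thesis by (rule filterlim_compose[OF _ lim])
qed

text \<open>No time derivative occurs, so multiplying the test function by a cutoff in time produces
  no boundary term at t = 0. The cutoffs are bounded by 1 and tend to 1 for t > 0, and for t \<le> 0
  both \<open>u\<close> and \<open>g\<close> vanish, so dominated convergence removes them.\<close>

lemma weak_gradient_zero_extension:
  fixes u g :: "('n::finite,'m::finite) pt \<Rightarrow> real"
  assumes u: "L2fun u" "\<And>p. snd p \<le> 0 \<Longrightarrow> u p = 0" and g: "L2fun g" "\<And>p. snd p \<le> 0 \<Longrightarrow> g p = 0"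
    and weak: "\<And>\<phi>. test_fun (Omega T) \<phi> \<Longrightarrow>
      (\<integral>p. u p * dx i \<phi> p \<partial>lborel) = - (\<integral>p. g p * \<phi> p \<partial>lborel)"
    and \<phi>: "test_fun {p. snd p < T} \<phi>"
  shows "(\<integral>p. u p * dx i \<phi> p \<partial>lborel) = - (\<integral>p. g p * \<phi> p \<partial>lborel)"
proof -
  define \<eta> where "\<eta> n p = flat_exp 1 (real (Suc n) * snd p + - 1)" for n and p :: "('n,'m) pt"
  have [measurable]: "\<eta> n \<in> borel_measurable borel" for n
    unfolding \<eta>_def
    by (intro borel_measurable_continuous_onI continuous_on_compose2[OF smooth_fun_continuous[OF smooth_fun_flat_exp, of UNIV]]
      continuous_intros) auto
  have lim: "(\<lambda>n. \<integral>p. h p * b p * \<eta> n p \<partial>lborel) \<longlonglongrightarrow> (\<integral>p. h p * b p \<partial>lborel)"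
    if h: "L2fun h" "\<And>p. snd p \<le> 0 \<Longrightarrow> h p = 0" and b: "compact_cont b" for h b
  proof -
    note [measurable] = L2fun_measurable[OF h(1)] compact_cont_measurable[OF b]
    show ?thesis
    proof (rule integral_dominated_convergence)
      show "integrable lborel (\<lambda>p. \<bar>h p * b p\<bar>)"
        by (intro integrable_abs L2fun_mult_integrable[OF h(1) compact_cont_L2fun[OF b]])
      show "AE p in lborel. (\<lambda>n. h p * b p * \<eta> n p) \<longlonglongrightarrow> h p * b p"
      proof (rule AE_I2)
        fix p
        show "(\<lambda>n. h p * b p * \<eta> n p) \<longlonglongrightarrow> h p * b p"
        proof (cases "snd p \<le> 0")
          case False
          then have "(\<lambda>n. h p * b p * \<eta> n p) \<longlonglongrightarrow> h p * b p * 1"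
            unfolding \<eta>_def by (intro tendsto_mult tendsto_const flat_exp_1_tendsto) simp
          then show ?thesis by simp
        qed (use h(2) in simp)
      qed
      show "AE p in lborel. norm (h p * b p * \<eta> n p) \<le> \<bar>h p * b p\<bar>" for n
        using flat_exp_1_bounds by (auto simp: abs_mult \<eta>_def intro!: mult_left_le)
    qed measurable
  qed
  have dxc: "compact_cont (dx i \<phi>)"
    unfolding dx_def[abs_def]
    by (rule dir_deriv_compact_cont[OF smooth_fun_dir_deriv[OF test_fun_smooth[OF \<phi>]] test_fun_compact_cont[OF \<phi>]])
  have "(\<integral>p. u p * dx i \<phi> p * \<eta> n p \<partial>lborel) = - (\<integral>p. g p * \<phi> p * \<eta> n p \<partial>lborel)" for n
    using weak[OF test_fun_times_initial_cutoff(1)[OF \<phi>, of "real (Suc n)"]]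
    unfolding test_fun_times_initial_cutoff(2)[OF \<phi>, of "real (Suc n)", OF of_nat_0_less_iff[THEN iffD2, OF zero_less_Suc]]
    by (simp add: \<eta>_def mult.assoc)
  then have "(\<lambda>n. - (\<integral>p. g p * \<phi> p * \<eta> n p \<partial>lborel)) \<longlonglongrightarrow> (\<integral>p. u p * dx i \<phi> p \<partial>lborel)"
    using lim[OF u dxc] by simp
  moreover have "(\<lambda>n. - (\<integral>p. g p * \<phi> p * \<eta> n p \<partial>lborel)) \<longlonglongrightarrow> - (\<integral>p. g p * \<phi> p \<partial>lborel)"
    by (intro tendsto_minus lim[OF g test_fun_compact_cont[OF \<phi>]])
  ultimately show ?thesis by (rule LIMSEQ_unique)
qed

section \<open>Explicit C1 cutoffs in time and space\<close>

lemma has_real_derivative_max_0_square: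
  "((\<lambda>s. (max 0 s)\<^sup>2) has_real_derivative 2 * max 0 s) (at (s::real))"
proof (cases s "0::real" rule: linorder_cases)
  case less
  have "((\<lambda>s. 0) has_real_derivative 2 * max 0 s) (at s)" using less by simp
  then show ?thesis
    by (rule has_field_derivative_transform_within_open[where S = "{..<0}"]) (use less in auto)
next
  case greater
  have "((\<lambda>s. s\<^sup>2) has_real_derivative 2 * max 0 s) (at s)"
    using greater by (auto intro!: derivative_eq_intros)
  then show ?thesis
    by (rule has_field_derivative_transform_within_open[where S = "{0<..}"]) (use greater in auto)
next
  case equal
  have "((\<lambda>h::real. (max 0 h)\<^sup>2 / h) \<longlongrightarrow> 0) (at 0)"
  proof (rule Lim_null_comparison)
    show "\<forall>\<^sub>F h::real in at 0. norm ((max 0 h)\<^sup>2 / h) \<le> \<bar>h\<bar>"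
      by (auto simp: eventually_at_filter max_def power2_eq_square)
    show "((\<lambda>h::real. \<bar>h\<bar>) \<longlongrightarrow> 0) (at 0)" by (rule tendsto_rabs_zero[OF tendsto_ident_at])
  qed
  then show ?thesis using equal by (simp add: DERIV_def)
qed

lemma dir_deriv_compose:
  assumes "dir_deriv v q q'" "\<And>s. (m has_real_derivative m' s) (at s)" "continuous_on UNIV m'"
  shows "dir_deriv v (\<lambda>p. m (q p)) (\<lambda>p. m' (q p) * q' p)"
  unfolding dir_deriv_def
proof (intro conjI allI)
  have q: "continuous_on UNIV q" "continuous_on UNIV q'" using assms(1) by (auto simp: dir_deriv_def)
  have "continuous_on UNIV m"
    using assms(2) by (meson DERIV_isCont continuous_at_imp_continuous_on)
  then show "continuous_on UNIV (\<lambda>p. m (q p))"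
    by (rule continuous_on_compose2[OF _ q(1)]) simp
  show "continuous_on UNIV (\<lambda>p. m' (q p) * q' p)"
    by (intro continuous_on_mult q continuous_on_compose2[OF assms(3) q(1)]) simp
  fix z
  have "(m has_real_derivative m' (q z)) (at (q (z + 0 *\<^sub>R v)))" using assms(2) by simp
  then show "((\<lambda>s. m (q (z + s *\<^sub>R v))) has_real_derivative m' (q z) * q' z) (at 0)"
    by (rule DERIV_chain2) (use assms(1) in \<open>simp add: dir_deriv_def\<close>)
qed

text \<open>The factor with T - t ends the weight at \<open>T\<close>, the factor with 1 + t begins
  it at -1. The latter is there only for compact support: the starting time lies in the region where
  the extended function is 0.\<close>

definition bump_time :: "real \<Rightarrow> real \<Rightarrow> real \<Rightarrow> real" where
  "bump_time k T t = exp (- k * t) * (max 0 (T - t))\<^sup>2 * (max 0 (1 + t))\<^sup>2"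

definition bump_time' :: "real \<Rightarrow> real \<Rightarrow> real \<Rightarrow> real" where
  "bump_time' k T t = exp (- k * t) * (- k * (max 0 (T - t))\<^sup>2 * (max 0 (1 + t))\<^sup>2
     - 2 * max 0 (T - t) * (max 0 (1 + t))\<^sup>2 + (max 0 (T - t))\<^sup>2 * (2 * max 0 (1 + t)))"

lemma bump_time_deriv: "(bump_time k T has_real_derivative bump_time' k T t) (at t)"
proof -
  have 1: "((\<lambda>t. exp (- k * t)) has_real_derivative exp (- k * t) * (- k)) (at t)"
    by (auto intro!: derivative_eq_intros)
  have 2: "((\<lambda>t. (max 0 (T - t))\<^sup>2) has_real_derivative 2 * max 0 (T - t) * (- 1)) (at t)"
    by (rule DERIV_chain2[OF has_real_derivative_max_0_square]) (auto intro!: derivative_eq_intros)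
  have 3: "((\<lambda>t. (max 0 (1 + t))\<^sup>2) has_real_derivative 2 * max 0 (1 + t) * 1) (at t)"
    by (rule DERIV_chain2[OF has_real_derivative_max_0_square]) (auto intro!: derivative_eq_intros)
  show ?thesis
    unfolding bump_time_def[abs_def]
    by (rule DERIV_cong[OF DERIV_mult[OF DERIV_mult[OF 1 2] 3]])
      (simp add: bump_time'_def algebra_simps)
qed

lemma bump_time_compact_cont: "compact_cont (bump_time k T)" "compact_cont (bump_time' k T)"
proof -
  have z: "bump_time k T t = 0" "bump_time' k T t = 0" if "norm t > max \<bar>T\<bar> 1" for t
    using that by (auto simp: bump_time_def bump_time'_def max_def split: if_splits)
  have "continuous_on UNIV (bump_time k T)" "continuous_on UNIV (bump_time' k T)"
    unfolding bump_time_def[abs_def] bump_time'_def[abs_def] by (intro continuous_intros)+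
  then show "compact_cont (bump_time k T)" "compact_cont (bump_time' k T)"
    using z unfolding compact_cont_def by blast+
qed

lemma bump_time_nonneg: "0 \<le> bump_time k T t"
  by (simp add: bump_time_def)

text \<open>The cutoff at \<open>T\<close> decreases and contributes with the favourable sign. The
  cutoff in the past increases, but for t > 0 its base B = 1 + t is at least 1, so 2 B \<le> 2 B^2;
  this is the 2 in the rate.\<close>

lemma bump_time'_le:
  assumes "t > 0"
  shows "bump_time' k T t \<le> (2 - k) * bump_time k T t"
proof -
  define A B where "A = max 0 (T - t)" and "B = max 0 (1 + t)"
  have A: "A \<ge> 0" and B: "B \<ge> 1" using assms by (auto simp: A_def B_def)
  have "A\<^sup>2 * (2 * B) \<le> A\<^sup>2 * (2 * B\<^sup>2)"
    using B by (intro mult_left_mono) (auto simp: power2_eq_square)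
  moreover have "0 \<le> 2 * A * B\<^sup>2" using A by simp
  ultimately have "- k * A\<^sup>2 * B\<^sup>2 - 2 * A * B\<^sup>2 + A\<^sup>2 * (2 * B) \<le> (2 - k) * (A\<^sup>2 * B\<^sup>2)"
    by (simp add: algebra_simps)
  then have "exp (- k * t) * (- k * A\<^sup>2 * B\<^sup>2 - 2 * A * B\<^sup>2 + A\<^sup>2 * (2 * B))
      \<le> exp (- k * t) * ((2 - k) * (A\<^sup>2 * B\<^sup>2))"
    by (rule mult_left_mono) simp
  then show ?thesis by (simp add: bump_time_def bump_time'_def A_def B_def mult_ac)
qed

text \<open>Since \<open>fst p\<close> is the pair (x, y), one radial function cuts off both groups
  of variables and leaves time alone.\<close>

definition bump_space :: "real \<Rightarrow> ('n::finite,'m::finite) pt \<Rightarrow> real" where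
  "bump_space R p = (max 0 (1 - (fst p \<bullet> fst p) / R\<^sup>2))\<^sup>2"

definition bump_space' :: "real \<Rightarrow> ('n::finite,'m::finite) pt \<Rightarrow> ('n,'m) pt \<Rightarrow> real" where
  "bump_space' R v p = 2 * max 0 (1 - (fst p \<bullet> fst p) / R\<^sup>2) * (- (2 * (fst p \<bullet> fst v) / R\<^sup>2))"

lemma bump_space_dir_deriv: "dir_deriv v (bump_space R) (bump_space' R v)"
proof -
  have q: "dir_deriv v (\<lambda>p. 1 - (fst p \<bullet> fst p) / R\<^sup>2) (\<lambda>p. - (2 * (fst p \<bullet> fst v) / R\<^sup>2))"
    unfolding dir_deriv_def divide_inverse
    by (intro conjI allI continuous_intros)
      (auto intro!: derivative_eq_intros simp: inner_add_left inner_add_right inner_commute)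
  show ?thesis
    unfolding bump_space_def[abs_def] bump_space'_def[abs_def]
    by (rule dir_deriv_compose[OF q has_real_derivative_max_0_square]) (intro continuous_intros)
qed

lemma bump_space_bounds: "0 \<le> bump_space R p" "bump_space R p \<le> 1"
proof -
  have "max 0 (1 - (fst p \<bullet> fst p) / R\<^sup>2) \<le> 1" by simp
  then show "bump_space R p \<le> 1" unfolding bump_space_def by (intro power_le_one) auto
qed (simp add: bump_space_def)

lemma bump_space_support: "R > 0 \<Longrightarrow> norm (fst p) \<ge> R \<Longrightarrow> max 0 (1 - (fst p \<bullet> fst p) / R\<^sup>2) = 0"
  by (simp add: power2_norm_eq_inner[symmetric] power_mono field_simps)

text \<open>The weight \<open>a\<close> stands for \<open>1\<close> or for the unbounded drift coefficient \<open>x\<^sub>l\<close>: the cutoff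
  gradient is of size \<open>norm (fst p) / R\<^sup>2\<close> on \<open>norm (fst p) \<le> R\<close>, which compensates one factor \<open>R\<close>.\<close>

lemma bump_space'_weighted_bound:
  assumes R: "R \<ge> 1" and v: "norm (fst v) \<le> 1" and a: "\<bar>a\<bar> \<le> max 1 (norm (fst p))"
  shows "\<bar>a * bump_space' R v p\<bar> \<le> 4"
proof (cases "norm (fst p) \<ge> R")
  case True
  then show ?thesis using bump_space_support[of R p] R by (simp add: bump_space'_def)
next
  case False
  define q where "q = max 0 (1 - (fst p \<bullet> fst p) / R\<^sup>2)"
  have q: "0 \<le> q" "q \<le> 1" by (auto simp: q_def)
  have "\<bar>fst p \<bullet> fst v\<bar> \<le> norm (fst p) * norm (fst v)" by (rule Cauchy_Schwarz_ineq2)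
  also have "\<dots> \<le> R * 1" using False v R by (intro mult_mono) auto
  finally have 1: "\<bar>fst p \<bullet> fst v\<bar> \<le> R" by simp
  have 2: "\<bar>a\<bar> \<le> R" using a False R by auto
  have "\<bar>a\<bar> * \<bar>fst p \<bullet> fst v\<bar> \<le> R * R" using 1 2 R by (intro mult_mono) auto
  then have "\<bar>a\<bar> * \<bar>fst p \<bullet> fst v\<bar> / R\<^sup>2 \<le> 1" using R by (simp add: power2_eq_square)
  then have "q * (\<bar>a\<bar> * \<bar>fst p \<bullet> fst v\<bar> / R\<^sup>2) \<le> 1 * 1" using q by (intro mult_mono) auto
  moreover have "\<bar>a * bump_space' R v p\<bar> = 4 * (q * (\<bar>a\<bar> * \<bar>fst p \<bullet> fst v\<bar> / R\<^sup>2))"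
    using q(1) unfolding bump_space'_def q_def[symmetric] by (simp add: abs_mult)
  ultimately show ?thesis by simp
qed

lemma bump_space_tendsto:
  "(\<lambda>n. bump_space (real (Suc n)) p) \<longlonglongrightarrow> 1" "(\<lambda>n. bump_space' (real (Suc n)) v p) \<longlonglongrightarrow> 0"
proof -
  have i: "(\<lambda>n. (inverse (real (Suc n)))\<^sup>2) \<longlonglongrightarrow> 0"
    using tendsto_power[OF LIMSEQ_inverse_real_of_nat, of 2] by simp
  have "(\<lambda>n. (max 0 (1 - (fst p \<bullet> fst p) * (inverse (real (Suc n)))\<^sup>2))\<^sup>2)
      \<longlonglongrightarrow> (max 0 (1 - (fst p \<bullet> fst p) * 0))\<^sup>2"
    by (intro tendsto_intros i)
  then show "(\<lambda>n. bump_space (real (Suc n)) p) \<longlonglongrightarrow> 1"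
    by (simp add: bump_space_def divide_inverse power_inverse)
  have "(\<lambda>n. 2 * max 0 (1 - (fst p \<bullet> fst p) * (inverse (real (Suc n)))\<^sup>2)
        * (- (2 * (fst p \<bullet> fst v) * (inverse (real (Suc n)))\<^sup>2)))
      \<longlonglongrightarrow> 2 * max 0 (1 - (fst p \<bullet> fst p) * 0) * (- (2 * (fst p \<bullet> fst v) * 0))"
    by (intro tendsto_intros i)
  then show "(\<lambda>n. bump_space' (real (Suc n)) v p) \<longlonglongrightarrow> 0"
    by (simp add: bump_space'_def divide_inverse power_inverse)
qed

section \<open>Removing the spatial cutoff, and uniqueness\<close>

lemma dir_deriv_snd: "dir_deriv v (\<lambda>p::('n::finite,'m::finite) pt. snd p) (\<lambda>_. snd v)"
  unfolding dir_deriv_def by (auto intro!: continuous_intros derivative_eq_intros)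

text \<open>The counterpart of \<open>L2lim_mult\<close>: here the two L2 functions are fixed and
  the weight converges, boundedly and pointwise but not uniformly, as happens when the cutoff radius
  tends to infinity.\<close>

lemma L2fun_mult_dominated:
  assumes g: "L2fun g" and h: "L2fun h"
    and b: "\<And>n. b n \<in> borel_measurable borel" "\<And>n x. \<bar>b n x\<bar> \<le> M" "\<And>x. (\<lambda>n. b n x) \<longlonglongrightarrow> b' x"
  shows "(\<lambda>n. \<integral>x. g x * h x * b n x \<partial>lborel) \<longlonglongrightarrow> (\<integral>x. g x * h x * b' x \<partial>lborel)"
proof (rule integral_dominated_convergence)
  note [measurable] = L2fun_measurable[OF g] L2fun_measurable[OF h] b(1)
  have [measurable]: "b' \<in> borel_measurable borel"
    by (rule borel_measurable_LIMSEQ_real[OF b(3)]) measurable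
  show "(\<lambda>x. g x * h x * b' x) \<in> borel_measurable lborel" by measurable
  show "(\<lambda>x. g x * h x * b n x) \<in> borel_measurable lborel" for n by measurable
  show "integrable lborel (\<lambda>x. M * \<bar>g x * h x\<bar>)"
    by (intro integrable_mult_right integrable_abs L2fun_mult_integrable g h)
  show "AE x in lborel. (\<lambda>n. g x * h x * b n x) \<longlonglongrightarrow> g x * h x * b' x"
    by (intro AE_I2 tendsto_mult tendsto_const b)
  show "AE x in lborel. norm (g x * h x * b n x) \<le> M * \<bar>g x * h x\<bar>" for n
    using b(2) by (auto simp: abs_mult mult.commute[of M] intro!: mult_left_mono)
qed

text \<open>All structure of the equation enters through \<open>coercive\<close>: the dissipation F
  G together with f u may be negative, but at most by C u^2. Choosing the time weight to decay fast
  enough turns the energy identity, whose two sides are equal, into a bound of the integral of u^2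
  \<theta> by 0.\<close>

lemma energy_uniqueness:
  fixes u f :: "('n::finite,'m::finite) pt \<Rightarrow> real" and F G :: "'n \<Rightarrow> ('n,'m) pt \<Rightarrow> real"
    and \<iota> :: "'m \<Rightarrow> 'n"
  assumes L2: "L2fun u" "L2fun f" "\<And>i. L2fun (F i)" "\<And>i. L2fun (G i)"
    and grad: "\<And>i \<phi>. test_fun {p. snd p < T} \<phi> \<Longrightarrow>
      (\<integral>p. u p * dx i \<phi> p \<partial>lborel) = - (\<integral>p. G i p * \<phi> p \<partial>lborel)"
    and eq: "\<And>\<phi>. test_fun {p. snd p < T} \<phi> \<Longrightarrow>
      (\<integral>p. - (\<Sum>i\<in>UNIV. F i p * dx i \<phi> p)
        + u p * (- (\<Sum>l\<in>UNIV. fst (fst p) $ \<iota> l * dy l \<phi> p) + dt \<phi> p) \<partial>lborel)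
      = (\<integral>p. f p * \<phi> p \<partial>lborel)"
    and coercive: "\<And>p. - C * (u p)\<^sup>2 \<le> (\<Sum>i\<in>UNIV. F i p * G i p) + f p * u p"
    and init: "\<And>p. snd p \<le> 0 \<Longrightarrow> u p = 0"
  shows "AE p in lborel. snd p < T \<longrightarrow> u p = 0"
proof -
  have *: "AE p in lborel. snd p < T' \<longrightarrow> u p = 0" if T': "T' < T" for T'
  proof -
    \<comment> \<open>Then \<theta>' \<le> (2 - k) \<theta> = - (1 + 2 C) \<theta> for positive
      times; 2 C cancels twice the coercivity loss and one \<theta> is left over.\<close>
    define k where "k = 3 + 2 * C"
    define \<theta> \<theta>' where "\<theta> = bump_time k T'" and "\<theta>' = bump_time' k T'"
    have \<theta>c: "compact_cont \<theta>" "compact_cont \<theta>'" unfolding \<theta>_def \<theta>'_def by (rule bump_time_compact_cont)+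
    obtain r B where r: "\<And>t. norm t > r \<Longrightarrow> \<theta> t = 0" "0 < B" "\<And>t. \<bar>\<theta> t\<bar> \<le> B"
      by (rule compact_contE[OF \<theta>c(1)], rule that)
    obtain B' where B': "0 < B'" "\<And>t. \<bar>\<theta>' t\<bar> \<le> B'" by (rule compact_contE[OF \<theta>c(2)], rule that)
    have \<theta>cont: "continuous_on UNIV \<theta>" "continuous_on UNIV \<theta>'" using \<theta>c by (auto simp: compact_cont_def)
    have \<theta>d: "dir_deriv v (\<lambda>p::('n,'m) pt. \<theta> (snd p)) (\<lambda>p. \<theta>' (snd p) * snd v)" for v
      unfolding \<theta>_def \<theta>'_def
      by (rule dir_deriv_compose[OF dir_deriv_snd bump_time_deriv]) (use \<theta>cont(2) in \<open>simp add: \<theta>'_def\<close>)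
    define X where "X n = (bump_space (real (Suc n)) :: ('n,'m) pt \<Rightarrow> real)" for n
    define X' where "X' n v = (bump_space' (real (Suc n)) v :: ('n,'m) pt \<Rightarrow> real)" for n v
    define \<psi> where "\<psi> n p = X n p * \<theta> (snd p)" for n p
    define D where "D n v p = X' n v p * \<theta> (snd p) + X n p * (\<theta>' (snd p) * snd v)" for n v p
    have \<psi>d: "dir_deriv v (\<psi> n) (D n v)" for n v
      unfolding \<psi>_def[abs_def] D_def[abs_def] X_def X'_def
      by (rule dir_deriv_mult[OF bump_space_dir_deriv \<theta>d])
    have \<psi>c: "compact_cont (\<psi> n)" for n
      unfolding compact_cont_def
    proof (intro conjI exI[of _ "real (Suc n) + \<bar>r\<bar>"] allI impI)
      show "continuous_on UNIV (\<psi> n)" using \<psi>d by (auto simp: dir_deriv_def)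
      fix p :: "('n,'m) pt" assume p: "real (Suc n) + \<bar>r\<bar> < norm p"
      have "norm p \<le> norm (fst p) + norm (snd p)"
        using norm_Pair_le[of "fst p" "snd p"] by simp
      then have "norm (fst p) \<ge> real (Suc n) \<or> norm (snd p) > r" using p by linarith
      then show "\<psi> n p = 0"
      proof
        assume "norm (fst p) \<ge> real (Suc n)"
        then have "X n p = 0" unfolding X_def bump_space_def by (subst bump_space_support) auto
        then show ?thesis by (simp add: \<psi>_def)
      qed (use r(1) in \<open>simp add: \<psi>_def\<close>)
    qed
    have Dm: "D n v \<in> borel_measurable borel" for n v
      by (rule compact_cont_measurable[OF dir_deriv_compact_cont[OF \<psi>d \<psi>c]])
    have \<psi>0: "\<psi> n p = 0" if "snd p \<ge> T'" for n p
      using that by (simp add: \<psi>_def \<theta>_def bump_time_def)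
    have Xb: "\<bar>X n p\<bar> \<le> 1" for n p using bump_space_bounds[of "real (Suc n)" p] by (simp add: X_def)
    have X'b: "\<bar>a * X' n v p\<bar> \<le> 4" if "norm (fst v) \<le> 1" "\<bar>a\<bar> \<le> max 1 (norm (fst p))" for a n v p
      unfolding X'_def by (rule bump_space'_weighted_bound) (use that in auto)
    have lim: "(\<lambda>n. X n p) \<longlonglongrightarrow> 1" "(\<lambda>n. X' n v p) \<longlonglongrightarrow> 0" for p v
      unfolding X_def X'_def by (rule bump_space_tendsto)+
    \<comment> \<open>The factor \<open>a\<close> is 1 or x_l. The third condition prevents the
      unbounded x_l from meeting \<theta>': in the y-directions \<open>snd v\<close> is 0, so only
      the spatial cutoff is differentiated.\<close>
    have aDb: "\<bar>a * D n v p\<bar> \<le> 4 * B + B'"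
      if "norm (fst v) \<le> 1" "\<bar>a\<bar> \<le> max 1 (norm (fst p))" "\<bar>a * snd v\<bar> \<le> 1" for a n v p
    proof -
      have "\<bar>a * D n v p\<bar> = \<bar>(a * X' n v p) * \<theta> (snd p) + X n p * (\<theta>' (snd p) * (a * snd v))\<bar>"
        by (simp add: D_def algebra_simps)
      also have "\<dots> \<le> \<bar>(a * X' n v p) * \<theta> (snd p)\<bar> + \<bar>X n p * (\<theta>' (snd p) * (a * snd v))\<bar>"
        by (rule abs_triangle_ineq)
      also have "\<bar>(a * X' n v p) * \<theta> (snd p)\<bar> \<le> 4 * B"
        unfolding abs_mult[of "a * X' n v p"] by (intro mult_mono X'b that r(3)) auto
      also have "\<bar>X n p * (\<theta>' (snd p) * (a * snd v))\<bar> \<le> 1 * (B' * 1)"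
        unfolding abs_mult[of "X n p"] abs_mult[of "\<theta>' (snd p)"]
        by (intro mult_mono Xb B'(2) that(3)) (use B'(1) in auto)
      finally show ?thesis by simp
    qed
    have aDlim: "(\<lambda>n. a * D n v p) \<longlonglongrightarrow> a * (\<theta>' (snd p) * snd v)" for a v p
    proof -
      have "(\<lambda>n. a * D n v p) \<longlonglongrightarrow> a * (0 * \<theta> (snd p) + 1 * (\<theta>' (snd p) * snd v))"
        unfolding D_def by (intro tendsto_intros lim)
      then show ?thesis by simp
    qed
    have id: "(\<integral>p. u p * u p * D n ((0, 0), 1) p \<partial>lborel)
        - (\<Sum>l\<in>UNIV. \<integral>p. u p * u p * (fst (fst p) $ \<iota> l * D n ((0, axis l 1), 0) p) \<partial>lborel)
      = 2 * ((\<Sum>i\<in>UNIV. \<integral>p. F i p * G i p * \<psi> n p \<partial>lborel)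
        + (\<Sum>i\<in>UNIV. \<integral>p. F i p * u p * D n ((axis i 1, 0), 0) p \<partial>lborel)
        + (\<integral>p. f p * u p * \<psi> n p \<partial>lborel))" for n
      by (rule energy_identity[OF L2 grad eq \<psi>c T' \<psi>0 \<psi>d \<psi>d \<psi>d])
    have l1: "(\<lambda>n. \<integral>p. u p * u p * D n ((0, 0), 1) p \<partial>lborel) \<longlonglongrightarrow> (\<integral>p. u p * u p * \<theta>' (snd p) \<partial>lborel)"
      by (rule L2fun_mult_dominated[where M = "4 * B + B'", OF L2(1) L2(1)], rule Dm)
        (use aDb[of "((0, 0), 1)" 1] aDlim[where a = 1 and v = "((0, 0), 1)"] in auto)
    \<comment> \<open>The derivative of the cutoff tends to 0 at each fixed point and stays bounded
      even after multiplication by x_l, so the drift term disappears.\<close>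
    have l2: "(\<lambda>n. \<integral>p. u p * u p * (fst (fst p) $ \<iota> l * D n ((0, axis l 1), 0) p) \<partial>lborel)
        \<longlonglongrightarrow> (\<integral>p. u p * u p * 0 \<partial>lborel)" for l
    proof (rule L2fun_mult_dominated[OF L2(1) L2(1)])
      show "(\<lambda>p. fst (fst p) $ \<iota> l * D n ((0, axis l 1), 0) p) \<in> borel_measurable borel" for n
        by (intro borel_measurable_times Dm borel_measurable_continuous_onI continuous_on_fst_nth)
      show "\<bar>fst (fst p) $ \<iota> l * D n ((0, axis l 1), 0) p\<bar> \<le> 4 * B + B'" for n p
      proof (rule aDb)
        have "\<bar>fst (fst p) $ \<iota> l\<bar> \<le> norm (fst (fst p))" by (rule component_le_norm_cart)
        also have "\<dots> \<le> norm (fst p)" using norm_fst_le[of "fst (fst p)" "snd (fst p)"] by simp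
        finally show "\<bar>fst (fst p) $ \<iota> l\<bar> \<le> max 1 (norm (fst p))" by simp
      qed auto
      show "(\<lambda>n. fst (fst p) $ \<iota> l * D n ((0, axis l 1), 0) p) \<longlonglongrightarrow> 0" for p
        using aDlim[where a = "fst (fst p) $ \<iota> l" and p = p and v = "((0, axis l 1), 0)"] by simp
    qed
    have l3: "(\<lambda>n. \<integral>p. F i p * u p * D n ((axis i 1, 0), 0) p \<partial>lborel) \<longlonglongrightarrow> (\<integral>p. F i p * u p * 0 \<partial>lborel)" for i
      by (rule L2fun_mult_dominated[where M = "4 * B + B'", OF L2(3) L2(1)], rule Dm)
        (use aDb[of "((axis i 1, 0), 0)" 1] aDlim[where a = 1 and v = "((axis i 1, 0), 0)"] in auto)
    have l4: "(\<lambda>n. \<integral>p. g p * h p * \<psi> n p \<partial>lborel) \<longlonglongrightarrow> (\<integral>p. g p * h p * \<theta> (snd p) \<partial>lborel)"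
      if "L2fun g" "L2fun h" for g h
    proof (rule L2fun_mult_dominated[OF that])
      show "\<psi> n \<in> borel_measurable borel" for n by (rule compact_cont_measurable[OF \<psi>c])
      show "\<bar>\<psi> n p\<bar> \<le> 1 * B" for n p
        unfolding \<psi>_def abs_mult by (intro mult_mono Xb r(3)) auto
      have "(\<lambda>n. \<psi> n p) \<longlonglongrightarrow> 1 * \<theta> (snd p)" for p
        unfolding \<psi>_def by (intro tendsto_intros lim)
      then show "(\<lambda>n. \<psi> n p) \<longlonglongrightarrow> \<theta> (snd p)" for p by simp
    qed
    have "(\<lambda>n. (\<integral>p. u p * u p * D n ((0, 0), 1) p \<partial>lborel)
        - (\<Sum>l\<in>UNIV. \<integral>p. u p * u p * (fst (fst p) $ \<iota> l * D n ((0, axis l 1), 0) p) \<partial>lborel))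
      \<longlonglongrightarrow> (\<integral>p. u p * u p * \<theta>' (snd p) \<partial>lborel) - (\<Sum>l\<in>(UNIV::'m set). \<integral>p. u p * u p * 0 \<partial>lborel)"
      by (intro tendsto_intros l1 l2)
    moreover have "(\<lambda>n. 2 * ((\<Sum>i\<in>UNIV. \<integral>p. F i p * G i p * \<psi> n p \<partial>lborel)
        + (\<Sum>i\<in>UNIV. \<integral>p. F i p * u p * D n ((axis i 1, 0), 0) p \<partial>lborel)
        + (\<integral>p. f p * u p * \<psi> n p \<partial>lborel)))
      \<longlonglongrightarrow> 2 * ((\<Sum>i\<in>UNIV. \<integral>p. F i p * G i p * \<theta> (snd p) \<partial>lborel)
        + (\<Sum>i\<in>UNIV. \<integral>p. F i p * u p * 0 \<partial>lborel)
        + (\<integral>p. f p * u p * \<theta> (snd p) \<partial>lborel))"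
      by (intro tendsto_intros l3 l4 L2)
    ultimately have id': "(\<integral>p. u p * u p * \<theta>' (snd p) \<partial>lborel)
      = 2 * ((\<Sum>i\<in>UNIV. \<integral>p. F i p * G i p * \<theta> (snd p) \<partial>lborel) + (\<integral>p. f p * u p * \<theta> (snd p) \<partial>lborel))"
      unfolding id using LIMSEQ_unique by fastforce
    have m: "(\<lambda>p::('n,'m) pt. \<theta> (snd p)) \<in> borel_measurable borel" "(\<lambda>p::('n,'m) pt. \<theta>' (snd p)) \<in> borel_measurable borel"
      by (intro borel_measurable_continuous_onI continuous_on_compose2[OF \<theta>cont(1)]
          continuous_on_compose2[OF \<theta>cont(2)] continuous_intros; simp)+
    have i: "integrable lborel (\<lambda>p. F i p * G i p * \<theta> (snd p))" "integrable lborel (\<lambda>p. f p * u p * \<theta> (snd p))"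
      "integrable lborel (\<lambda>p. u p * u p * \<theta>' (snd p))" "integrable lborel (\<lambda>p. u p * u p * \<theta> (snd p))" for i
      by (rule L2fun_mult_bounded_integrable[OF L2(3) L2(4) m(1) r(3)],
          rule L2fun_mult_bounded_integrable[OF L2(2) L2(1) m(1) r(3)],
          rule L2fun_mult_bounded_integrable[OF L2(1) L2(1) m(2) B'(2)],
          rule L2fun_mult_bounded_integrable[OF L2(1) L2(1) m(1) r(3)])
    have \<theta>nn: "0 \<le> \<theta> t" for t unfolding \<theta>_def by (rule bump_time_nonneg)
    \<comment> \<open>The integral of \<open>E\<close> is 0 by the energy identity, and
      \<open>E\<close> is at least u^2 \<theta> pointwise.\<close>
    define E where "E p = 2 * ((\<Sum>i\<in>UNIV. F i p * G i p * \<theta> (snd p)) + f p * u p * \<theta> (snd p)) - u p * u p * \<theta>' (snd p)" for p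
    have Eint: "integrable lborel E"
      unfolding E_def[abs_def] using i by auto
    have "(\<integral>p. E p \<partial>lborel) = 0"
    proof -
      have "(\<integral>p. E p \<partial>lborel) = 2 * ((\<Sum>i\<in>UNIV. \<integral>p. F i p * G i p * \<theta> (snd p) \<partial>lborel) + (\<integral>p. f p * u p * \<theta> (snd p) \<partial>lborel))
         - (\<integral>p. u p * u p * \<theta>' (snd p) \<partial>lborel)"
        unfolding E_def
        by (intro has_bochner_integral_integral_eq has_bochner_integral_add
            has_bochner_integral_diff has_bochner_integral_sum has_bochner_integral_mult_right
            has_bochner_integral_integrable i)
      then show ?thesis using id' by simp
    qed
    moreover have EE: "u p * u p * \<theta> (snd p) \<le> E p" for p
    proof -
      have "- C * (u p)\<^sup>2 * \<theta> (snd p) \<le> ((\<Sum>i\<in>UNIV. F i p * G i p) + f p * u p) * \<theta> (snd p)"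
        using coercive[of p] \<theta>nn by (rule mult_right_mono)
      also have "\<dots> = (\<Sum>i\<in>UNIV. F i p * G i p * \<theta> (snd p)) + f p * u p * \<theta> (snd p)"
        by (simp add: distrib_right sum_distrib_right)
      finally have 1: "- C * (u p)\<^sup>2 * \<theta> (snd p) \<le> \<dots>" .
      \<comment> \<open>The weight still increases at the beginning of its support; there t \<le> 0
        and \<open>u\<close> vanishes.\<close>
      have 2: "(u p)\<^sup>2 * \<theta>' (snd p) \<le> (u p)\<^sup>2 * ((2 - k) * \<theta> (snd p))"
      proof (cases "snd p \<le> 0")
        case False
        then show ?thesis unfolding \<theta>_def \<theta>'_def by (intro mult_left_mono bump_time'_le) auto
      qed (use init in simp)
      have 3: "(u p)\<^sup>2 * ((2 - k) * \<theta> (snd p)) = 2 * (- C * (u p)\<^sup>2 * \<theta> (snd p)) - (u p)\<^sup>2 * \<theta> (snd p)"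
        by (simp add: k_def algebra_simps)
      have solve: "x \<le> 2 * S - y" if "z \<le> S" "y \<le> 2 * z - x" for x y z S :: real
        using that by linarith
      show ?thesis
        unfolding E_def power2_eq_square[symmetric] by (rule solve[OF 1 2[unfolded 3]])
    qed
    ultimately have "(\<integral>p. u p * u p * \<theta> (snd p) \<partial>lborel) \<le> 0"
      using integral_mono[OF i(4) Eint EE] by simp
    then have "(\<integral>p. u p * u p * \<theta> (snd p) \<partial>lborel) = 0"
      using \<theta>nn by (intro antisym integral_nonneg_AE) auto
    then have "AE p in lborel. u p * u p * \<theta> (snd p) = 0"
      by (subst (asm) integral_nonneg_eq_0_iff_AE[OF i(4)]) (use \<theta>nn in auto)
    then show ?thesis
    proof eventually_elim
      case (elim p)
      show ?case
      proof
        assume "snd p < T'"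
        show "u p = 0"
        proof (cases "snd p \<le> 0")
          case False
          then have "\<theta> (snd p) > 0" using \<open>snd p < T'\<close> by (simp add: \<theta>_def bump_time_def max_def)
          then show ?thesis using elim by simp
        qed (use init in simp)
      qed
    qed
  qed
  \<comment> \<open>The result is so far confined to times below some T' < T; the values T - 1 / (n
    + 1) exhaust the interval with countably many null sets.\<close>
  have "AE p in lborel. \<forall>n. snd p < T - 1 / real (Suc n) \<longrightarrow> u p = 0"
    unfolding AE_all_countable by (intro allI *) simp
  then show ?thesis
  proof eventually_elim
    case (elim p)
    show ?case
    proof
      assume "snd p < T"
      then obtain n where "1 / real (Suc n) < T - snd p"
        using reals_Archimedean[of "T - snd p"] by (auto simp: divide_inverse)
      then have "snd p < T - 1 / real (Suc n)" by linarith
      then show "u p = 0" using elim by blast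
    qed
  qed
qed

section \<open>Reduction of the theorem to the abstract uniqueness statement\<close>

lemma ellipticity_entry_bound:
  fixes A :: "'n::finite \<Rightarrow> 'n \<Rightarrow> real"
  assumes sym: "\<And>i k. A i k = A k i"
    and Q: "\<And>\<xi>::real^'n. 0 \<le> (\<Sum>i\<in>UNIV. \<Sum>k\<in>UNIV. \<xi>$i * A i k * \<xi>$k)"
      "\<And>\<xi>::real^'n. (\<Sum>i\<in>UNIV. \<Sum>k\<in>UNIV. \<xi>$i * A i k * \<xi>$k) \<le> lam * (norm \<xi>)\<^sup>2"
  shows "\<bar>A i k\<bar> \<le> 2 * lam"
proof -
  define q where "q \<xi> = (\<Sum>i\<in>UNIV. \<Sum>k\<in>UNIV. \<xi>$i * A i k * \<xi>$k)" for \<xi> :: "real^'n"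
  have ax: "(\<Sum>k\<in>UNIV. axis j 1 $ k * h k) = h j" "(\<Sum>k\<in>UNIV. h k * axis j 1 $ k) = h j"
    for j :: 'n and h :: "'n \<Rightarrow> real"
    by (simp_all add: axis_def if_distrib if_distribR sum.delta cong: if_cong)
  have b: "(\<Sum>i\<in>UNIV. \<Sum>k\<in>UNIV. axis j 1 $ i * A i k * axis l 1 $ k) = A j l" for j l
    by (simp add: ax mult.assoc flip: sum_distrib_left)
  have qjj: "q (axis j 1) = A j j" for j unfolding q_def by (rule b)
  \<comment> \<open>Polarisation: the diagonal entries lie between 0 and \<open>lam\<close>, and the
    form at e_i + e_k lies between 0 and 4 \<open>lam\<close>, as this vector has norm at most 2
    (attained for i = k). Solving for the mixed entry gives the bound.\<close>
  have q2: "q (axis i 1 + axis k 1) = A i i + A k k + 2 * A i k"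
    unfolding q_def using sym[of k i] by (simp add: b distrib_left distrib_right sum.distrib)
  have nj: "norm (axis j 1 :: real^'n) = 1" for j by (rule norm_axis_1)
  have "norm (axis i 1 + axis k 1 :: real^'n) \<le> 2"
    using norm_triangle_ineq[of "axis i 1 :: real^'n" "axis k 1"] nj[of i] nj[of k] by simp
  then have n2: "(norm (axis i 1 + axis k 1 :: real^'n))\<^sup>2 \<le> 2\<^sup>2" by (rule power_mono) simp
  have "0 \<le> A j j" "A j j \<le> lam" for j
    using Q(1)[of "axis j 1"] Q(2)[of "axis j 1"] unfolding q_def[symmetric] qjj nj by auto
  note d = this[of i] this[of k]
  have "0 \<le> A i i + A k k + 2 * A i k" using Q(1)[of "axis i 1 + axis k 1"] unfolding q_def[symmetric] q2 .
  moreover have "A i i + A k k + 2 * A i k \<le> lam * 2\<^sup>2"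
  proof -
    have "A i i + A k k + 2 * A i k \<le> lam * (norm (axis i 1 + axis k 1 :: real^'n))\<^sup>2"
      using Q(2)[of "axis i 1 + axis k 1"] unfolding q_def[symmetric] q2 .
    also have "\<dots> \<le> lam * 2\<^sup>2" using n2 d by (intro mult_left_mono) auto
    finally show ?thesis .
  qed
  ultimately show ?thesis using d by (simp add: abs_le_iff)
qed

lemma L2_on_indicator:
  assumes "L2_on S f" "S \<in> sets borel"
  shows "L2fun (\<lambda>p. indicator S p * f p)"
  unfolding L2fun_def
proof
  show "(\<lambda>p. indicator S p * f p) \<in> borel_measurable borel"
    using assms by (auto simp: L2_on_def)
  have "(\<lambda>p. (indicator S p * f p)\<^sup>2) = (\<lambda>p. indicator S p *\<^sub>R (f p)\<^sup>2)"
    by (auto simp: indicator_def)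
  then show "integrable lborel (\<lambda>p. (indicator S p * f p)\<^sup>2)"
    using assms(1) by (simp add: L2_on_def set_integrable_def)
qed

text \<open>The injection \<iota> expresses m \<le> n and selects the x-coordinates that drive y.
  \<open>G\<close> is the weak x-gradient. The initial value 0 is encoded in \<open>weak_eq\<close>:
  its test functions need not vanish near t = 0, yet no boundary term appears there.\<close>

theorem theorem1p1:
  fixes T lam :: real
    and \<iota> :: "'m::finite \<Rightarrow> 'n::finite"
    and a :: "'n \<Rightarrow> 'n \<Rightarrow> real^'n \<Rightarrow> real \<Rightarrow> real"
    and c :: "real^'n \<Rightarrow> real \<Rightarrow> real"
    and d :: "'n \<Rightarrow> real^'n \<Rightarrow> real \<Rightarrow> real"
    and u :: "('n,'m) pt \<Rightarrow> real"
    and G :: "'n \<Rightarrow> ('n,'m) pt \<Rightarrow> real"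
  assumes T_pos: "T > 0"
    and m_le_n: "inj \<iota>"
    and lam: "lam > 1"
    and a_sym: "\<And>i k x t. 0 < t \<Longrightarrow> t < T \<Longrightarrow> a i k x t = a k i x t"
    and a_ell: "\<And>x t (\<xi>::real^'n). 0 < t \<Longrightarrow> t < T \<Longrightarrow>
         inverse lam * (norm \<xi>)\<^sup>2 \<le> (\<Sum>i\<in>UNIV. \<Sum>k\<in>UNIV. \<xi>$i * a i k x t * \<xi>$k)
       \<and> (\<Sum>i\<in>UNIV. \<Sum>k\<in>UNIV. \<xi>$i * a i k x t * \<xi>$k) \<le> lam * (norm \<xi>)\<^sup>2"
    and a_lip: "\<And>i k. \<exists>L. L-lipschitz_on (UNIV \<times> {0<..<T}) (\<lambda>(x,t). a i k x t)"
    and c_meas: "(\<lambda>(x,t). c x t) \<in> borel_measurable lborel"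
    and d_meas: "\<And>i. (\<lambda>(x,t). d i x t) \<in> borel_measurable lborel"
    and cd_bdd: "\<exists>M. \<forall>x t. 0 < t \<and> t < T \<longrightarrow> \<bar>c x t\<bar> \<le> M \<and> (\<forall>i. \<bar>d i x t\<bar> \<le> M)"
    and u_L2: "L2_on (Omega T) u"
    and G_L2: "\<And>i. L2_on (Omega T) (G i)"
    and G_weak_grad: "\<And>i \<phi>. test_fun (Omega T) \<phi> \<Longrightarrow>
         (LINT p:Omega T|lborel. u p * dx i \<phi> p) = - (LINT p:Omega T|lborel. G i p * \<phi> p)"
    and transport_L2: "\<exists>h. L2_on (Omega T) h \<and> (\<forall>\<phi>. test_fun (Omega T) \<phi> \<longrightarrow>
         (LINT p:Omega T|lborel. u p * (- (\<Sum>l\<in>UNIV. (fst (fst p))$(\<iota> l) * dy l \<phi> p) - dt \<phi> p))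
         = (LINT p:Omega T|lborel. h p * \<phi> p))"
    and weak_eq: "\<And>\<phi>. test_fun {p. snd p < T} \<phi> \<Longrightarrow>
         (LINT p:Omega T|lborel.
             - (\<Sum>i\<in>UNIV. \<Sum>k\<in>UNIV. a i k (fst (fst p)) (snd p) * G k p * dx i \<phi> p)
             + u p * (- (\<Sum>l\<in>UNIV. (fst (fst p))$(\<iota> l) * dy l \<phi> p) + dt \<phi> p))
         = (LINT p:Omega T|lborel.
             (c (fst (fst p)) (snd p) * u p
              + (\<Sum>i\<in>UNIV. d i (fst (fst p)) (snd p) * G i p)) * \<phi> p)"
  shows "AE p in lborel. p \<in> Omega T \<longrightarrow> u p = 0"
proof -
  obtain M where "\<forall>x t. 0 < t \<and> t < T \<longrightarrow> \<bar>c x t\<bar> \<le> M \<and> (\<forall>i. \<bar>d i x t\<bar> \<le> M)"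
    using cd_bdd by blast
  then have M: "\<bar>c x t\<bar> \<le> M" "\<bar>d i x t\<bar> \<le> M" if "0 < t" "t < T" for x t i
    using that by auto
  have M0: "0 \<le> M" using M(1)[of "T/2" 0] T_pos by simp
  have in_Omega: "p \<in> Omega T \<longleftrightarrow> 0 < snd p \<and> snd p < T" for p :: "('n,'m) pt"
    by (simp add: Omega_def)
  have "open (Omega T :: ('n,'m) pt set)"
    unfolding Omega_def by (intro open_Collect_conj open_Collect_less continuous_intros)
  then have Om: "(Omega T :: ('n,'m) pt set) \<in> sets borel" by simp
  define I where "I = (indicator (Omega T) :: ('n,'m) pt \<Rightarrow> real)"
  have Im: "I \<in> borel_measurable borel" unfolding I_def using Om by simp
  have I: "I p = 1" if "p \<in> Omega T" for p using that by (simp add: I_def)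
  have I0: "I p = 0" if "p \<notin> Omega T" for p using that by (simp add: I_def)
  define U where "U p = I p * u p" for p
  define H where "H i p = I p * G i p" for i p
  \<comment> \<open>The indicator is attached to each coefficient as well as to \<open>H\<close>.
    This is harmless because it is idempotent, and it makes the coefficients bounded and measurable
    on the whole space.\<close>
  define F where "F i p = (\<Sum>k\<in>UNIV. (I p * a i k (fst (fst p)) (snd p)) * H k p)" for i p
  define f where "f p = (I p * c (fst (fst p)) (snd p)) * U p
    + (\<Sum>i\<in>UNIV. (I p * d i (fst (fst p)) (snd p)) * H i p)" for p
  have U: "L2fun U" unfolding U_def[abs_def] I_def by (rule L2_on_indicator[OF u_L2 Om])
  have H: "L2fun (H i)" for i unfolding H_def[abs_def] I_def by (rule L2_on_indicator[OF G_L2 Om])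
  have proj: "(\<lambda>p::('n,'m) pt. (fst (fst p), snd p)) \<in> borel \<rightarrow>\<^sub>M borel"
    by (intro borel_measurable_continuous_onI continuous_intros)
  have am: "(\<lambda>p. I p * a i k (fst (fst p)) (snd p)) \<in> borel_measurable borel" for i k
  proof -
    obtain L where "L-lipschitz_on (UNIV \<times> {0<..<T}) (\<lambda>(x,t). a i k x t)" using a_lip by blast
    then have "continuous_on (UNIV \<times> {0<..<T}) (\<lambda>(x,t). a i k x t)" by (rule lipschitz_on_continuous_on)
    then have "continuous_on (Omega T) (\<lambda>p::('n,'m) pt. (\<lambda>(x,t). a i k x t) (fst (fst p), snd p))"
      by (rule continuous_on_compose2) (auto intro!: continuous_intros simp: in_Omega)
    from borel_measurable_continuous_on_indicator[OF Om this]
    show ?thesis by (simp add: I_def)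
  qed
  \<comment> \<open>Ellipticity controls the quadratic form; bounds on the single entries are what
    makes the flux square integrable.\<close>
  have ab: "\<bar>I p * a i k (fst (fst p)) (snd p)\<bar> \<le> 2 * lam" for i k p
  proof (cases "p \<in> Omega T")
    case True
    then have t: "0 < snd p" "snd p < T" by (auto simp: in_Omega)
    have "\<bar>a i k (fst (fst p)) (snd p)\<bar> \<le> 2 * lam"
    proof (rule ellipticity_entry_bound)
      fix \<xi> :: "real^'n"
      have "0 \<le> inverse lam * (norm \<xi>)\<^sup>2" using lam by simp
      also have "\<dots> \<le> (\<Sum>i\<in>UNIV. \<Sum>k\<in>UNIV. \<xi>$i * a i k (fst (fst p)) (snd p) * \<xi>$k)"
        using a_ell[OF t] by blast
      finally show "0 \<le> (\<Sum>i\<in>UNIV. \<Sum>k\<in>UNIV. \<xi>$i * a i k (fst (fst p)) (snd p) * \<xi>$k)" .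
    qed (use a_sym[OF t] a_ell[OF t] in auto)
    then show ?thesis using True by (simp add: I)
  qed (use lam in \<open>simp add: I0\<close>)
  have cm: "(\<lambda>p. I p * c (fst (fst p)) (snd p)) \<in> borel_measurable borel"
    using measurable_compose[OF proj, of "\<lambda>(x,t). c x t"] c_meas
    by (intro borel_measurable_times Im) simp
  have dm: "(\<lambda>p. I p * d i (fst (fst p)) (snd p)) \<in> borel_measurable borel" for i
    using measurable_compose[OF proj, of "\<lambda>(x,t). d i x t"] d_meas[of i]
    by (intro borel_measurable_times Im) simp
  have cb: "\<bar>I p * c (fst (fst p)) (snd p)\<bar> \<le> M" "\<bar>I p * d i (fst (fst p)) (snd p)\<bar> \<le> M" for p i
    using M(1)[of "snd p" "fst (fst p)"] M(2)[of "snd p" i "fst (fst p)"] M0 by (auto simp: I_def indicator_def in_Omega)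
  have F: "L2fun (F i)" for i
    unfolding F_def[abs_def] by (intro L2fun_sum finite L2fun_mult_bounded[OF H am ab])
  have f: "L2fun f"
    unfolding f_def[abs_def]
    by (intro L2fun_add L2fun_sum finite L2fun_mult_bounded[OF U cm cb(1)] L2fun_mult_bounded[OF H dm cb(2)])
  have zero: "U p = 0" "H i p = 0" if "snd p \<le> 0" for p i
    using that by (auto simp: U_def H_def I_def indicator_def in_Omega)
  \<comment> \<open>The gradient relation is given only for test functions supported inside the
    strip and has to be extended to t \<le> 0; the equation comes with the larger class
    already.\<close>
  have grad: "(\<integral>p. U p * dx i \<phi> p \<partial>lborel) = - (\<integral>p. H i p * \<phi> p \<partial>lborel)"
    if "test_fun {p. snd p < T} \<phi>" for i \<phi>
  proof (rule weak_gradient_zero_extension[OF U zero(1) H zero(2) _ that])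
    fix \<phi> :: "('n,'m) pt \<Rightarrow> real" assume "test_fun (Omega T) \<phi>"
    from G_weak_grad[OF this, of i]
    show "(\<integral>p. U p * dx i \<phi> p \<partial>lborel) = - (\<integral>p. H i p * \<phi> p \<partial>lborel)"
      by (simp add: set_lebesgue_integral_def U_def H_def I_def mult.assoc)
  qed
  have eq: "(\<integral>p. - (\<Sum>i\<in>UNIV. F i p * dx i \<phi> p)
        + U p * (- (\<Sum>l\<in>UNIV. fst (fst p) $ \<iota> l * dy l \<phi> p) + dt \<phi> p) \<partial>lborel)
      = (\<integral>p. f p * \<phi> p \<partial>lborel)" if "test_fun {p. snd p < T} \<phi>" for \<phi>
  proof -
    have l: "indicator (Omega T) p *\<^sub>R (- (\<Sum>i\<in>UNIV. \<Sum>k\<in>UNIV. a i k (fst (fst p)) (snd p) * G k p * dx i \<phi> p)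
             + u p * (- (\<Sum>l\<in>UNIV. (fst (fst p))$(\<iota> l) * dy l \<phi> p) + dt \<phi> p))
        = - (\<Sum>i\<in>UNIV. F i p * dx i \<phi> p)
          + U p * (- (\<Sum>l\<in>UNIV. fst (fst p) $ \<iota> l * dy l \<phi> p) + dt \<phi> p)" for p
      by (cases "p \<in> Omega T") (simp_all add: F_def U_def H_def I I0 sum_distrib_right)
    have r: "indicator (Omega T) p *\<^sub>R ((c (fst (fst p)) (snd p) * u p
              + (\<Sum>i\<in>UNIV. d i (fst (fst p)) (snd p) * G i p)) * \<phi> p) = f p * \<phi> p" for p
      by (cases "p \<in> Omega T") (simp_all add: f_def U_def H_def I I0)
    show ?thesis using weak_eq[OF that] unfolding set_lebesgue_integral_def l r .
  qed
  \<comment> \<open>The summand \<open>M\<close> bounds the effect of c. For each of the n indices,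
    Young's inequality estimates |d_i H_i U| by H_i^2 / lam + lam M^2 U^2, and ellipticity absorbs
    the gradient parts completely.\<close>
  define C where "C = M + real CARD('n) * (lam * M\<^sup>2)"
  have coercive: "- C * (U p)\<^sup>2 \<le> (\<Sum>i\<in>UNIV. F i p * H i p) + f p * U p" for p
  proof (cases "p \<in> Omega T")
    case True
    then have t: "0 < snd p" "snd p < T" by (auto simp: in_Omega)
    let ?x = "fst (fst p)" and ?t = "snd p"
    have "inverse lam * (\<Sum>i\<in>UNIV. (H i p)\<^sup>2) = inverse lam * (norm (\<chi> i. H i p))\<^sup>2"
      by (simp add: norm_vec_def L2_set_def sum_nonneg)
    also have "\<dots> \<le> (\<Sum>i\<in>UNIV. \<Sum>k\<in>UNIV. (\<chi> i. H i p) $ i * a i k ?x ?t * (\<chi> i. H i p) $ k)"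
      using a_ell[OF t] by blast
    also have "\<dots> = (\<Sum>i\<in>UNIV. F i p * H i p)"
      unfolding F_def sum_distrib_right by (simp add: I[OF True] mult_ac)
    finally have 1: "(\<Sum>i\<in>UNIV. inverse lam * (H i p)\<^sup>2) \<le> (\<Sum>i\<in>UNIV. F i p * H i p)"
      by (simp add: sum_distrib_left)
    have "- (M * (U p)\<^sup>2) \<le> c ?x ?t * (U p)\<^sup>2"
      using mult_right_mono[of "- M" "c ?x ?t" "(U p)\<^sup>2"] M(1)[OF t, of ?x] by (simp add: abs_le_iff)
    moreover have "(\<Sum>i\<in>UNIV. - (inverse lam * (H i p)\<^sup>2 + lam * M\<^sup>2 * (U p)\<^sup>2)) \<le> (\<Sum>i\<in>UNIV. d i ?x ?t * H i p * U p)"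
    proof (rule sum_mono)
      fix i
      have D2: "(d i ?x ?t)\<^sup>2 \<le> M\<^sup>2"
        using M(2)[OF t, of i ?x] M0 by (simp add: abs_le_square_iff[symmetric])
      have il: "inverse lam * (lam * z) = z" for z using lam by simp
      define e where "e = d i ?x ?t * U p"
      \<comment> \<open>Expanding this sum of squares gives 2 H^2 + 2 lam e H + 2 lam^2 e^2 \<ge> 0,
        which is Young's inequality after division by 2 lam.\<close>
      have "0 \<le> (H i p + lam * e)\<^sup>2 + (lam * e)\<^sup>2 + (H i p)\<^sup>2" by simp
      then have "- (2 * lam * (e * H i p)) \<le> 2 * (H i p)\<^sup>2 + 2 * (lam\<^sup>2 * e\<^sup>2)"
        by (simp add: power2_eq_square algebra_simps)
      then have "inverse lam * - (lam * (e * H i p)) \<le> inverse lam * ((H i p)\<^sup>2 + lam\<^sup>2 * e\<^sup>2)"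
        using lam by (intro mult_left_mono) auto
      then have "- (e * H i p) \<le> inverse lam * (H i p)\<^sup>2 + lam * e\<^sup>2"
        using lam by (simp add: power2_eq_square distrib_left mult.assoc il)
      also have "lam * e\<^sup>2 \<le> lam * M\<^sup>2 * (U p)\<^sup>2"
        using D2 lam by (simp add: e_def power_mult_distrib mult_right_mono)
      finally show "- (inverse lam * (H i p)\<^sup>2 + lam * M\<^sup>2 * (U p)\<^sup>2) \<le> d i ?x ?t * H i p * U p"
        by (simp add: e_def mult_ac)
    qed
    moreover have "(\<Sum>i\<in>(UNIV::'n set). - (inverse lam * (H i p)\<^sup>2 + lam * M\<^sup>2 * (U p)\<^sup>2))
        = - (\<Sum>i\<in>UNIV. inverse lam * (H i p)\<^sup>2) - real CARD('n) * (lam * M\<^sup>2) * (U p)\<^sup>2"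
      unfolding sum_negf sum.distrib by (simp add: mult.assoc)
    moreover have "f p * U p = c ?x ?t * (U p)\<^sup>2 + (\<Sum>i\<in>UNIV. d i ?x ?t * H i p * U p)"
      by (simp add: f_def I[OF True] distrib_right sum_distrib_right power2_eq_square)
    moreover have "- C * (U p)\<^sup>2 = - (M * (U p)\<^sup>2) - real CARD('n) * (lam * M\<^sup>2) * (U p)\<^sup>2"
      by (simp add: C_def algebra_simps)
    ultimately show ?thesis using 1 by linarith
  qed (simp add: U_def F_def H_def I0)
  have "AE p in lborel. snd p < T \<longrightarrow> U p = 0"
    by (rule energy_uniqueness[OF U f F H grad eq coercive zero(1)])
  then show ?thesis
    by eventually_elim (auto simp: U_def I in_Omega)
qed

end
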